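(* Let $\kappa\le\lambda$ be infinite cardinals and let $\pi$ be an automorphism of $\mathcal{P}(\lambda)/\mathcal{I}_\kappa$. Then: (1) the set of classes $[A]$ of fixed points $A$ of $\pi$ is a $<\mathrm{cf}(\kappa)$-complete subalgebra of $\mathcal{P}(\lambda)/\mathcal{I}_\kappa$; (2) if $\eta$ is a regular cardinal with $\eta\neq\mathrm{cf}(\kappa)$ and $\langle A_\alpha:\alpha<\eta\rangle$ is a sequence of fixed points of $\pi$ such that $|\bigcup\{A_\alpha:\alpha<\beta\}\setminus A_\beta|<\kappa$ for all $\beta<\eta$, then $\bigcup\{A_\alpha:\alpha<\eta\}$ is a fixed point of $\pi$; (3) if $\kappa$ is regular and $\lambda>\kappa$, then for every $A\subseteq\lambda$ there is a fixed point $B\subseteq\lambda$ with $A\subseteq B$ and $|B|\le|A|+\kappa^+$; (4) if $\pi$ is cardinality-preserving and $\kappa$ is uncountable, then for every $A\subseteq\lambda$ there is a fixed point $B\subseteq\lambda$ with $A\subseteq B$ and $|B|=|A|$.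
   Context: $\mathcal{I}_\kappa$ is the ideal of subsets of $\lambda$ of cardinality less than $\kappa$. A fixed point of $\pi$ is a set $A\subseteq\lambda$ with $\pi([A])=[A]$. A Boolean algebra is $<\mu$-complete if every subset of cardinality less than $\mu$ has a least upper bound. $\pi$ is cardinality-preserving if for every $A\subseteq\lambda$ there is $B$ with $|B|=|A|$ and $\pi([A])=[B]$. *)

theory Defs
  imports Main
begin

unbundle cardinal_syntax

text \<open>
  A cardinal is a cardinal well-order \<open>r\<close> (\<open>Card_order r\<close>). Its elements are those of
  \<open>Field r\<close>, and cardinals living on different types are compared by
  \<open>\<le>o\<close>, \<open><o\<close>, \<open>=o\<close>.
\<close>

text \<open>
  The cofinality is determined only up to \<open>=o\<close>. The library predicate \<open>cofinal\<close> asks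
  for strict upper bounds, which for infinite cardinals is the same as being unbounded.
\<close>

definition cf :: "'b rel \<Rightarrow> 'b rel" where
  "cf r = (SOME m. (\<exists>K. K \<subseteq> Field r \<and> cofinal K r \<and> m = |K| ) \<and>
                   (\<forall>K. K \<subseteq> Field r \<and> cofinal K r \<longrightarrow> m \<le>o |K| ))"

definition small_ideal :: "'a rel \<Rightarrow> 'b rel \<Rightarrow> 'a set set" where
  "small_ideal lam kap = {A. A \<subseteq> Field lam \<and> |A| <o kap}"

definition ideal_rel :: "'a rel \<Rightarrow> 'b rel \<Rightarrow> 'a set rel" where
  "ideal_rel lam kap =
     {(A, B). A \<subseteq> Field lam \<and> B \<subseteq> Field lam \<and> sym_diff A B \<in> small_ideal lam kap}"

definition cls :: "'a rel \<Rightarrow> 'b rel \<Rightarrow> 'a set \<Rightarrow> 'a set set" where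
  "cls lam kap A = ideal_rel lam kap `` {A}"

definition quot :: "'a rel \<Rightarrow> 'b rel \<Rightarrow> 'a set set set" where
  "quot lam kap = Pow (Field lam) // ideal_rel lam kap"

text \<open>
  The operations below are well defined on classes, so each union is over copies of a
  single class.
\<close>

definition qmeet :: "'a rel \<Rightarrow> 'b rel \<Rightarrow> 'a set set \<Rightarrow> 'a set set \<Rightarrow> 'a set set" where
  "qmeet lam kap x y = (\<Union>A\<in>x. \<Union>B\<in>y. cls lam kap (A \<inter> B))"

definition qjoin :: "'a rel \<Rightarrow> 'b rel \<Rightarrow> 'a set set \<Rightarrow> 'a set set \<Rightarrow> 'a set set" where
  "qjoin lam kap x y = (\<Union>A\<in>x. \<Union>B\<in>y. cls lam kap (A \<union> B))"

definition qcompl :: "'a rel \<Rightarrow> 'b rel \<Rightarrow> 'a set set \<Rightarrow> 'a set set" where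
  "qcompl lam kap x = (\<Union>A\<in>x. cls lam kap (Field lam - A))"

definition qzero :: "'a rel \<Rightarrow> 'b rel \<Rightarrow> 'a set set" where
  "qzero lam kap = cls lam kap {}"

definition qone :: "'a rel \<Rightarrow> 'b rel \<Rightarrow> 'a set set" where
  "qone lam kap = cls lam kap (Field lam)"

definition qle :: "'a rel \<Rightarrow> 'b rel \<Rightarrow> 'a set set \<Rightarrow> 'a set set \<Rightarrow> bool" where
  "qle lam kap x y \<longleftrightarrow> qmeet lam kap x y = x"

definition automorphism :: "'a rel \<Rightarrow> 'b rel \<Rightarrow> ('a set set \<Rightarrow> 'a set set) \<Rightarrow> bool" where
  "automorphism lam kap \<pi> \<longleftrightarrow>
     bij_betw \<pi> (quot lam kap) (quot lam kap) \<and>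
     \<pi> (qzero lam kap) = qzero lam kap \<and>
     \<pi> (qone lam kap) = qone lam kap \<and>
     (\<forall>x\<in>quot lam kap. \<forall>y\<in>quot lam kap.
        \<pi> (qmeet lam kap x y) = qmeet lam kap (\<pi> x) (\<pi> y) \<and>
        \<pi> (qjoin lam kap x y) = qjoin lam kap (\<pi> x) (\<pi> y)) \<and>
     (\<forall>x\<in>quot lam kap. \<pi> (qcompl lam kap x) = qcompl lam kap (\<pi> x))"

definition fixed_point ::
    "'a rel \<Rightarrow> 'b rel \<Rightarrow> ('a set set \<Rightarrow> 'a set set) \<Rightarrow> 'a set \<Rightarrow> bool" where
  "fixed_point lam kap \<pi> A \<longleftrightarrow> A \<subseteq> Field lam \<and> \<pi> (cls lam kap A) = cls lam kap A"

definition cardinality_preserving ::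
    "'a rel \<Rightarrow> 'b rel \<Rightarrow> ('a set set \<Rightarrow> 'a set set) \<Rightarrow> bool" where
  "cardinality_preserving lam kap \<pi> \<longleftrightarrow>
     (\<forall>A. A \<subseteq> Field lam \<longrightarrow>
        (\<exists>B. B \<subseteq> Field lam \<and> |B| =o |A| \<and> \<pi> (cls lam kap A) = cls lam kap B))"

definition is_lub :: "('c \<Rightarrow> 'c \<Rightarrow> bool) \<Rightarrow> 'c set \<Rightarrow> 'c set \<Rightarrow> 'c \<Rightarrow> bool" where
  "is_lub le C S b \<longleftrightarrow>
     b \<in> C \<and> (\<forall>s\<in>S. le s b) \<and> (\<forall>c\<in>C. (\<forall>s\<in>S. le s c) \<longrightarrow> le b c)"

definition lt_complete :: "('c \<Rightarrow> 'c \<Rightarrow> bool) \<Rightarrow> 'c set \<Rightarrow> 'm rel \<Rightarrow> bool" where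
  "lt_complete le C mu \<longleftrightarrow> (\<forall>S. S \<subseteq> C \<and> |S| <o mu \<longrightarrow> (\<exists>b. is_lub le C S b))"

definition subalgebra :: "'a rel \<Rightarrow> 'b rel \<Rightarrow> 'a set set set \<Rightarrow> bool" where
  "subalgebra lam kap F \<longleftrightarrow>
     F \<subseteq> quot lam kap \<and> qzero lam kap \<in> F \<and> qone lam kap \<in> F \<and>
     (\<forall>x\<in>F. \<forall>y\<in>F. qmeet lam kap x y \<in> F \<and> qjoin lam kap x y \<in> F) \<and>
     (\<forall>x\<in>F. qcompl lam kap x \<in> F)"

text \<open>
  A \<open><\<mu>\<close>-complete subalgebra is a subalgebra that is \<open><\<mu>\<close>-complete in its own right and
  whose least upper bounds of fewer than \<open>\<mu>\<close> elements are those of the ambient algebra.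
\<close>

definition lt_complete_subalgebra :: "'a rel \<Rightarrow> 'b rel \<Rightarrow> 'm rel \<Rightarrow> 'a set set set \<Rightarrow> bool" where
  "lt_complete_subalgebra lam kap mu F \<longleftrightarrow>
     subalgebra lam kap F \<and>
     lt_complete (qle lam kap) F mu \<and>
     (\<forall>S b. S \<subseteq> F \<and> |S| <o mu \<and> is_lub (qle lam kap) F S b \<longrightarrow>
        is_lub (qle lam kap) (quot lam kap) S b)"

end

theory Submission
  imports Defs
begin

text \<open>
  Write \<open>A \<lesssim> B\<close> for \<open>|A - B| < \<kappa>\<close>. An automorphism preserves least upper bounds, so for (1) and (2)
  it suffices that the unions in question are least upper bounds with respect to \<open>\<lesssim>\<close>. For (2) this
  says that an increasing union of \<open>\<eta>\<close> sets of size less than \<open>\<kappa>\<close> has size less than \<open>\<kappa>\<close>, which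
  can only fail when \<open>\<eta> = cf(\<kappa>)\<close>. For (3) and (4), one closes \<open>A\<close> under \<open>\<pi>\<close> and its inverse
  along a regular cardinal different from \<open>cf(\<kappa>)\<close>: \<open>\<kappa>\<^sup>+\<close> in (3), and \<open>\<omega>\<close> or \<open>\<omega>\<^sub>1\<close> in (4). In (3) the
  size is controlled because \<open>\<pi>([A])\<close> has a representative of size at most \<open>|A| + \<kappa>\<^sup>+\<close>, a theorem
  of Balcar and Frankiewicz for \<open>\<kappa> = \<omega>\<close> whose proof works for all regular \<open>\<kappa>\<close>.
\<close>

section \<open>Cofinality and unions of small sets\<close>

lemma Cinfinite_finite_ordLess: "finite A \<Longrightarrow> Cinfinite r \<Longrightarrow> |A| <o r"
  using ordLess_ordLeq_trans[of "|A|" natLeq r] natLeq_ordLeq_cinfinite[of r]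
  by (simp flip: finite_iff_ordLess_natLeq)

lemma Cinfinite_Well_order: "Cinfinite r \<Longrightarrow> Well_order r"
  by (auto simp: card_order_on_def)

text \<open>A well-order shorter than \<open>r\<close> is isomorphic to a proper initial segment of
  \<open>r\<close>. Sizes below \<open>kap\<close> thereby become elements of \<open>kap\<close>, so
  that families of sizes can be bounded by means of cofinality.\<close>

lemma ordLess_card_of_underS:
  assumes "Card_order r" and "|A| <o r"
  obtains a where "a \<in> Field r" and "|A| =o |underS r a|"
proof -
  have "Well_order r" using assms(1) by (auto simp: card_order_on_def)
  then obtain a where a: "a \<in> Field r" and iso: "|A| =o Restr r (underS r a)"
    using assms(2) ordLess_iff_ordIso_Restr[of r "|A|"] card_of_Well_order by blast
  have "Field (Restr r (underS r a)) = underS r a"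
    using \<open>Well_order r\<close> by (simp add: Field_Restr_ofilter wo_rel.underS_ofilter wo_rel_def)
  then have "|A| =o |underS r a|"
    using card_of_cong[OF iso] by (simp add: Field_card_of)
  with a show thesis by (rule that)
qed

lemma subset_of_size:
  assumes "Card_order r" and "r \<le>o |A|"
  obtains B where "B \<subseteq> A" and "|B| =o r"
proof -
  have r: "|Field r| =o r" using assms(1) by (rule card_of_Field_ordIso)
  then have "|Field r| \<le>o |A|" using assms(2) by (rule ordIso_ordLeq_trans)
  then obtain B where B: "B \<subseteq> A" "|Field r| =o |B|"
    using internalize_card_of_ordLeq2[of "Field r" A] by auto
  show thesis using that[OF B(1) ordIso_transitive[OF ordIso_symmetric[OF B(2)] r]] .
qed

lemma UNION_ordLess_if_bounded:
  assumes "Cinfinite r" and "|I| <o r" and "|M| <o r" and "\<And>i. i \<in> I \<Longrightarrow> |A i| \<le>o |M|"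
  shows "|\<Union>i\<in>I. A i| <o r"
\<comment> \<open>The bound by the sum \<open>I <+> M\<close> needs this sum to be infinite; if it
  is finite, so is the union.\<close>
proof (cases "finite (I <+> M)")
  case True
  then have "finite (\<Union>i\<in>I. A i)"
    using assms(4) card_of_ordLeq_finite by auto
  then show ?thesis using assms(1) by (rule Cinfinite_finite_ordLess)
next
  case False
  have "|\<Union>i\<in>I. A i| \<le>o |I <+> M|"
    using False assms(4) ordLeq_transitive[OF _ card_of_Plus2]
    by (intro card_of_UNION_ordLeq_infinite) (auto simp: card_of_Plus1)
  moreover have "|I <+> M| <o r"
    using assms by (intro card_of_Plus_ordLess_infinite_Field) (auto simp: cinfinite_def)
  ultimately show ?thesis by (rule ordLeq_ordLess_trans)
qed

lemma bounded_if_not_cofinal: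
  assumes "Well_order r" and "K \<subseteq> Field r" and "\<not> cofinal K r"
  obtains a where "a \<in> Field r" and "\<And>k. k \<in> K \<Longrightarrow> (k, a) \<in> r"
proof -
  obtain a where a: "a \<in> Field r" and "\<forall>b\<in>K. a = b \<or> (a, b) \<notin> r"
    using assms(3) by (auto simp: cofinal_def)
  moreover have "(k, a) \<in> r" if "k \<in> K" for k
  proof -
    have "(k, a) \<in> r \<or> (a, k) \<in> r"
      using wo_rel.TOTALS[OF wo_rel.intro[OF assms(1)]] a that assms(2) by blast
    moreover have "(a, a) \<in> r"
      using wo_rel.TOTALS[OF wo_rel.intro[OF assms(1)]] a by blast
    ultimately show ?thesis using \<open>\<forall>b\<in>K. a = b \<or> (a, b) \<notin> r\<close> that by metis
  qed
  ultimately show thesis using that by blast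
qed

text \<open>The sizes of cofinal subsets are well-orders, so there is a least one as soon as some
  cofinal subset exists; the whole field is one because an infinite cardinal has no largest element.
  This justifies the choice in \<open>cf\<close>.\<close>

lemma cf_props:
  assumes "Cinfinite kap"
  shows "\<exists>K. K \<subseteq> Field kap \<and> cofinal K kap \<and> cf kap = |K|"
    and "K \<subseteq> Field kap \<Longrightarrow> cofinal K kap \<Longrightarrow> cf kap \<le>o |K|"
proof -
  let ?R = "{|K| | K. K \<subseteq> Field kap \<and> cofinal K kap}"
  have "cofinal (Field kap) kap"
    using infinite_Card_order_limit[of kap] assms by (simp add: cofinal_def cinfinite_def)
  then have "?R \<noteq> {}" by blast
  moreover have "\<forall>r\<in>?R. Well_order r" using card_of_Well_order by blast
  ultimately obtain m where "m \<in> ?R" "\<forall>m'\<in>?R. m \<le>o m'"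
    using exists_minim_Well_order[of ?R] by blast
  then have "\<exists>m. (\<exists>K. K \<subseteq> Field kap \<and> cofinal K kap \<and> m = |K| ) \<and>
                   (\<forall>K. K \<subseteq> Field kap \<and> cofinal K kap \<longrightarrow> m \<le>o |K| )"
    by blast
  from someI_ex[OF this, folded cf_def]
  show "\<exists>K. K \<subseteq> Field kap \<and> cofinal K kap \<and> cf kap = |K|"
    and "K \<subseteq> Field kap \<Longrightarrow> cofinal K kap \<Longrightarrow> cf kap \<le>o |K|"
    by blast+
qed

lemma Card_order_cf: "Cinfinite kap \<Longrightarrow> Card_order (cf kap)"
  by (drule cf_props(1)) (auto simp: card_of_Card_order)

lemma cf_ordLeq: "Cinfinite kap \<Longrightarrow> cf kap \<le>o kap"
  using cf_props(1)[of kap] ordLeq_ordIso_trans[OF card_of_mono1 card_of_Field_ordIso, of _ kap] by auto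

lemma cf_ordIso_if_regularCard: "Cinfinite kap \<Longrightarrow> regularCard kap \<Longrightarrow> cf kap =o kap"
  using cf_props(1)[of kap] unfolding regularCard_def by auto

lemma bounded_if_ordLess_cf:
  assumes "Cinfinite kap" and "K \<subseteq> Field kap" and "|K| <o cf kap"
  obtains a where "a \<in> Field kap" and "\<And>k. k \<in> K \<Longrightarrow> (k, a) \<in> kap"
proof (rule bounded_if_not_cofinal[OF Cinfinite_Well_order[OF assms(1)] assms(2)])
  show "\<not> cofinal K kap" using cf_props(2)[OF assms(1,2)] not_ordLess_ordLeq[OF assms(3)] by blast
qed (rule that)

lemma bounded_if_ordLess_regularCard:
  assumes "Cinfinite eta" and "regularCard eta" and "K \<subseteq> Field eta" and "|K| <o eta"
  obtains a where "a \<in> Field eta" and "\<And>k. k \<in> K \<Longrightarrow> (k, a) \<in> eta"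
proof (rule bounded_if_not_cofinal[OF Cinfinite_Well_order[OF assms(1)] assms(3)])
  show "\<not> cofinal K eta" using assms(2,3) not_ordLess_ordIso[OF assms(4)] unfolding regularCard_def by blast
qed (rule that)

lemma underS_mono: "Well_order r \<Longrightarrow> (a, b) \<in> r \<Longrightarrow> underS r a \<subseteq> underS r b"
  by (rule underS_incr) (auto simp: order_on_defs)

text \<open>Read as elements of \<open>kap\<close>, the fewer than \<open>cf kap\<close> sizes have
  a common upper bound \<open>a\<close>, so the segment below \<open>a\<close> bounds all
  \<open>A i\<close> uniformly.\<close>

lemma UNION_ordLess_cf:
  assumes kap: "Cinfinite kap" and I: "|I| <o cf kap" and A: "\<And>i. i \<in> I \<Longrightarrow> |A i| <o kap"
  shows "|\<Union>i\<in>I. A i| <o kap"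
proof -
  have "\<exists>a. a \<in> Field kap \<and> |A i| =o |underS kap a|" if "i \<in> I" for i
    using ordLess_card_of_underS[OF _ A[OF that]] kap by blast
  then obtain k where k: "\<And>i. i \<in> I \<Longrightarrow> k i \<in> Field kap" "\<And>i. i \<in> I \<Longrightarrow> |A i| =o |underS kap (k i)|"
    by metis
  have "|k ` I| <o cf kap" using card_of_image I by (rule ordLeq_ordLess_trans)
  then obtain a where a: "a \<in> Field kap" "\<And>j. j \<in> k ` I \<Longrightarrow> (j, a) \<in> kap"
    using bounded_if_ordLess_cf[OF kap, of "k ` I"] k(1) by blast
  have "|A i| \<le>o |underS kap a|" if "i \<in> I" for i
    using k(2)[OF that] card_of_mono1[OF underS_mono[OF Cinfinite_Well_order[OF kap] a(2)]] that
    by (blast intro: ordIso_ordLeq_trans)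
  moreover have "|underS kap a| <o kap" using kap a(1) by (auto intro: card_of_underS)
  moreover have "|I| <o kap" using I cf_ordLeq[OF kap] by (rule ordLess_ordLeq_trans)
  ultimately show ?thesis using UNION_ordLess_if_bounded[OF kap] by blast
qed

text \<open>The combinatorial core of (2), by cases on the position of \<open>eta\<close> relative
  to \<open>cf kap\<close> and \<open>kap\<close>. At \<open>eta =o cf kap\<close> an increasing
  union of small sets can reach size \<open>kap\<close>.\<close>

lemma UNION_relChain_ordLess:
  fixes D :: "'c \<Rightarrow> 'a set"
  assumes kap: "Cinfinite kap" and eta: "Cinfinite eta" "regularCard eta" and neq: "\<not> eta =o cf kap"
    and chain: "relChain eta D" and D: "\<And>b. b \<in> Field eta \<Longrightarrow> |D b| <o kap"
  shows "|\<Union>b\<in>Field eta. D b| <o kap"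
proof -
  have Wk: "Well_order kap" and We: "Well_order eta"
    using kap eta Cinfinite_Well_order by blast+
  have Fe: "|Field eta| =o eta" using eta card_of_Field_ordIso by blast
  consider "eta <o cf kap" | "cf kap <o eta" "eta <o kap" | "eta =o kap" | "kap <o eta"
    using neq ordLess_or_ordLeq[OF We Wk] ordLess_or_ordLeq[OF We card_order_on_well_order_on[OF Card_order_cf[OF kap]]]
      ordLeq_iff_ordLess_or_ordIso[of kap eta] ordLeq_iff_ordLess_or_ordIso[of "cf kap" eta]
      ordIso_symmetric[of "cf kap" eta] ordIso_symmetric[of kap eta] by blast
  then show ?thesis
  proof cases
    case 1
    show ?thesis using ordIso_ordLess_trans[OF Fe 1] D by (rule UNION_ordLess_cf[OF kap])
  next
    \<comment> \<open>There are fewer than \<open>kap\<close> sets here, so a uniform bound below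
      \<open>kap\<close> on their sizes is enough.\<close>
    case 2
    obtain K where K: "K \<subseteq> Field kap" "cofinal K kap" "cf kap = |K|"
      using cf_props(1)[OF kap] by blast
    \<comment> \<open>Otherwise fewer than \<open>eta\<close> many of the \<open>D b\<close> have sizes unbounded in \<open>kap\<close>,
      and by regularity a single \<open>D c\<close> contains all of them.\<close>
    have "\<exists>k\<in>K. \<forall>b\<in>Field eta. |D b| \<le>o |underS kap k|"
    proof (rule ccontr)
      assume "\<not> ?thesis"
      then have "\<forall>k\<in>K. \<exists>b\<in>Field eta. |underS kap k| <o |D b|"
        using not_ordLeq_iff_ordLess[OF card_of_Well_order card_of_Well_order] by metis
      then obtain b where b: "\<And>k. k \<in> K \<Longrightarrow> b k \<in> Field eta" "\<And>k. k \<in> K \<Longrightarrow> |underS kap k| <o |D (b k)|"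
        by metis
      have "|b ` K| <o eta" using card_of_image 2(1) unfolding K(3) by (rule ordLeq_ordLess_trans)
      then obtain c where c: "c \<in> Field eta" "\<And>j. j \<in> b ` K \<Longrightarrow> (j, c) \<in> eta"
        using bounded_if_ordLess_regularCard[OF eta, of "b ` K"] b(1) by blast
      obtain a where a: "a \<in> Field kap" "|D c| =o |underS kap a|"
        using ordLess_card_of_underS[OF _ D[OF c(1)]] kap by blast
      obtain k where k: "k \<in> K" "(a, k) \<in> kap" using K(2) a(1) unfolding cofinal_def by blast
      have "|D c| \<le>o |underS kap k|"
        using ordIso_ordLeq_trans[OF a(2) card_of_mono1] underS_mono[OF Wk k(2)] by blast
      also have "|underS kap k| <o |D (b k)|" using b(2) k(1) by blast
      also have "|D (b k)| \<le>o |D c|"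
        using chain c(2) k(1) by (intro card_of_mono1) (auto simp: relChain_def)
      finally show False using ordLess_irreflexive by blast
    qed
    then obtain k where "k \<in> K" "\<forall>b\<in>Field eta. |D b| \<le>o |underS kap k|" by blast
    moreover from this have "|underS kap k| <o kap" using kap K(1) by (auto intro: card_of_underS)
    moreover have "|Field eta| <o kap" using ordIso_ordLess_trans[OF Fe 2(2)] .
    ultimately show ?thesis using UNION_ordLess_if_bounded[OF kap] by blast
  next
    \<comment> \<open>Here \<open>kap\<close> is itself regular, so \<open>cf kap\<close> equals
      \<open>eta\<close>, which is excluded.\<close>
    case 3
    then have "regularCard kap" using regularCard_ordIso eta by blast
    then have "eta =o cf kap"
      using cf_ordIso_if_regularCard[OF kap] 3 ordIso_symmetric ordIso_transitive by blast
    with neq show ?thesis by blast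
  next
    \<comment> \<open>A subset \<open>E\<close> of the union of size \<open>kap\<close> would be
      smaller than the regular \<open>eta\<close>, hence contained in a single \<open>D b\<close>,
      which is too small for it.\<close>
    case 4
    show ?thesis
    proof (rule ccontr)
      assume "\<not> ?thesis"
      then have le: "kap \<le>o |\<Union>b\<in>Field eta. D b|"
        using not_ordLess_iff_ordLeq[OF Wk card_of_Well_order] by blast
      obtain E where E: "E \<subseteq> (\<Union>b\<in>Field eta. D b)" "|E| =o kap"
        by (rule subset_of_size[OF conjunct2[OF kap] le])
      then have "|E| <o eta" using ordIso_ordLess_trans[OF E(2) 4] by blast
      then obtain b where "b \<in> Field eta" "E \<subseteq> D b"
        using regularCard_UNION[OF _ eta(2) chain E(1)] eta by blast
      then have "|E| <o kap" using D card_of_mono1 ordLeq_ordLess_trans by blast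
      with E(2) show False using not_ordLess_ordIso by blast
    qed
  qed
qed

section \<open>Inclusion modulo small sets\<close>

definition asub :: "'b rel \<Rightarrow> 'a set \<Rightarrow> 'a set \<Rightarrow> bool" where
  "asub kap A B \<longleftrightarrow> |A - B| <o kap"

lemma ordLess_mono: "A \<subseteq> B \<Longrightarrow> |B| <o r \<Longrightarrow> |A| <o r"
  by (rule ordLeq_ordLess_trans[OF card_of_mono1])

lemma asub_subset: "Cinfinite kap \<Longrightarrow> A \<subseteq> B \<Longrightarrow> asub kap A B"
  by (simp add: asub_def Diff_eq_empty_iff[THEN iffD2] Cinfinite_finite_ordLess)

lemma asub_trans:
  assumes "Cinfinite kap" and "asub kap A B" and "asub kap B C"
  shows "asub kap A C"
  unfolding asub_def
  by (rule ordLess_mono[OF _ Un_Cinfinite_bound_strict[OF assms(2,3)[unfolded asub_def] assms(1)]]) blast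

lemma asub_small: "asub kap A B \<Longrightarrow> Cinfinite kap \<Longrightarrow> |B| <o kap \<Longrightarrow> |A| <o kap"
  unfolding asub_def
  by (rule ordLess_mono[OF _ Un_Cinfinite_bound_strict[of "A - B" kap B]]) auto

lemma small_asub: "|A| <o kap \<Longrightarrow> asub kap A B"
  unfolding asub_def by (rule ordLess_mono[of _ A]) auto

lemma asub_Int:
  assumes "Cinfinite kap" and "asub kap A B" and "asub kap A C"
  shows "asub kap A (B \<inter> C)"
  unfolding asub_def
  by (rule ordLess_mono[OF _ Un_Cinfinite_bound_strict[OF assms(2,3)[unfolded asub_def] assms(1)]]) blast

lemma asub_card_ordLeq:
  assumes "asub kap A B" and "|B| \<le>o r" and "kap \<le>o r" and "Cinfinite r"
  shows "|A| \<le>o r"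
proof -
  have "|A - B| \<le>o r"
    using assms(1,3) unfolding asub_def by (rule ordLess_imp_ordLeq[OF ordLess_ordLeq_trans])
  then have "|(A - B) \<union> B| \<le>o r" using assms(2,4) by (rule Un_Cinfinite_bound)
  moreover have "|A| \<le>o |(A - B) \<union> B|" by (rule card_of_mono1) blast
  ultimately show ?thesis by (rule ordLeq_transitive[rotated])
qed

lemma UN_asub_if_ordLess_cf:
  assumes "Cinfinite kap" and "|I| <o cf kap" and "\<And>i. i \<in> I \<Longrightarrow> asub kap (A i) C"
  shows "asub kap (\<Union>i\<in>I. A i) C"
  using UNION_ordLess_cf[OF assms(1,2), of "\<lambda>i. A i - C"] assms(3)
  by (simp add: asub_def)

text \<open>Removing \<open>C\<close> from the unions of earlier members leaves an increasing
  sequence of small sets, since such a union lies almost in \<open>A b\<close> and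
  \<open>A b\<close> almost in \<open>C\<close>. Hence \<open>UNION_relChain_ordLess\<close>
  applies.\<close>

lemma UN_asub_if_almost_chain:
  fixes A :: "'c \<Rightarrow> 'a set"
  assumes kap: "Cinfinite kap" and eta: "Cinfinite eta" "regularCard eta" and neq: "\<not> eta =o cf kap"
    and chain: "\<And>b. b \<in> Field eta \<Longrightarrow> asub kap (\<Union>a\<in>underS eta b. A a) (A b)"
    and C: "\<And>a. a \<in> Field eta \<Longrightarrow> asub kap (A a) C"
  shows "asub kap (\<Union>a\<in>Field eta. A a) C"
proof -
  let ?D = "\<lambda>b. (\<Union>a\<in>underS eta b. A a) - C"
  have We: "Well_order eta" using eta Cinfinite_Well_order by blast
  have "relChain eta ?D"
    using underS_mono[OF We] unfolding relChain_def by blast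
  moreover have "|?D b| <o kap" if "b \<in> Field eta" for b
    using asub_trans[OF kap chain C] that unfolding asub_def by blast
  ultimately have "|\<Union>b\<in>Field eta. ?D b| <o kap"
    by (rule UNION_relChain_ordLess[OF kap eta neq])
  moreover have "(\<Union>a\<in>Field eta. A a) - C \<subseteq> (\<Union>b\<in>Field eta. ?D b)"
  proof
    fix x assume "x \<in> (\<Union>a\<in>Field eta. A a) - C"
    then obtain a where a: "a \<in> Field eta" "x \<in> A a" "x \<notin> C" by blast
    \<comment> \<open>An infinite cardinal has no last element, so every index \<open>a\<close>
      counts as earlier for some \<open>b\<close>.\<close>
    obtain b where "b \<in> Field eta" "a \<noteq> b" "(a, b) \<in> eta"
      using infinite_Card_order_limit[of eta a] eta a(1) by (auto simp: cinfinite_def)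
    with a show "x \<in> (\<Union>b\<in>Field eta. ?D b)" by (auto simp: underS_def)
  qed
  ultimately show ?thesis unfolding asub_def by (rule ordLess_mono[rotated])
qed

text \<open>
  An automorphism of the quotient algebra and its inverse are represented by maps \<open>f\<close> and \<open>g\<close>
  on representatives. Only the induced order matters.
\<close>

locale almost_automorphism =
  fixes L :: "'a set" and kap :: "'b rel" and f g :: "'a set \<Rightarrow> 'a set"
  assumes kap: "Cinfinite kap"
    and f_subset: "A \<subseteq> L \<Longrightarrow> f A \<subseteq> L"
    and g_subset: "A \<subseteq> L \<Longrightarrow> g A \<subseteq> L"
    and f_asub_iff: "A \<subseteq> L \<Longrightarrow> B \<subseteq> L \<Longrightarrow> asub kap (f A) (f B) \<longleftrightarrow> asub kap A B"
    and fg_asub: "A \<subseteq> L \<Longrightarrow> asub kap (f (g A)) A"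
    and asub_fg: "A \<subseteq> L \<Longrightarrow> asub kap A (f (g A))"
begin

abbreviation asub' (infix \<open>\<lesssim>\<close> 50) where "A \<lesssim> B \<equiv> asub kap A B"

lemma subset_lesssim: "A \<subseteq> B \<Longrightarrow> A \<lesssim> B"
  using kap by (rule asub_subset)

lemma lesssim_trans [trans]: "A \<lesssim> B \<Longrightarrow> B \<lesssim> C \<Longrightarrow> A \<lesssim> C"
  using kap by (rule asub_trans)

lemma f_mono: "A \<subseteq> L \<Longrightarrow> B \<subseteq> L \<Longrightarrow> A \<lesssim> B \<Longrightarrow> f A \<lesssim> f B"
  by (simp add: f_asub_iff)

lemma g_asub_iff: assumes "A \<subseteq> L" "B \<subseteq> L" shows "g A \<lesssim> g B \<longleftrightarrow> A \<lesssim> B"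
proof -
  have "g A \<lesssim> g B \<longleftrightarrow> f (g A) \<lesssim> f (g B)" using assms by (simp add: f_asub_iff g_subset)
  also have "\<dots> \<longleftrightarrow> A \<lesssim> B" using fg_asub asub_fg assms lesssim_trans by meson
  finally show ?thesis .
qed

lemma g_mono: "A \<subseteq> L \<Longrightarrow> B \<subseteq> L \<Longrightarrow> A \<lesssim> B \<Longrightarrow> g A \<lesssim> g B"
  by (simp add: g_asub_iff)

lemma gf_asub: assumes "A \<subseteq> L" shows "g (f A) \<lesssim> A"
  using fg_asub[of "f A"] f_asub_iff[of "g (f A)" A] f_subset g_subset assms by simp

lemma asub_gf: assumes "A \<subseteq> L" shows "A \<lesssim> g (f A)"
  using asub_fg[of "f A"] f_asub_iff[of A "g (f A)"] f_subset g_subset assms by simp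

text \<open>The assumptions are symmetric in \<open>f\<close> and \<open>g\<close>, so every result
  on \<open>f\<close> also holds for \<open>g\<close>.\<close>

lemma inverse: "almost_automorphism L kap g f"
  by unfold_locales (simp_all add: kap f_subset g_subset g_asub_iff gf_asub asub_gf)

text \<open>A small set lies almost inside every set, in particular inside \<open>g {}\<close>, and
  \<open>f (g {})\<close> is almost empty.\<close>

lemma f_small: assumes "A \<subseteq> L" "|A| <o kap" shows "|f A| <o kap"
proof -
  have "A \<lesssim> g {}" using assms(2) by (rule small_asub)
  then have "f A \<lesssim> f (g {})" using assms(1) by (simp add: f_asub_iff g_subset)
  also have "f (g {}) \<lesssim> {}" by (rule fg_asub) simp
  finally show ?thesis unfolding asub_def by simp
qed

text \<open>Pulled back by \<open>g\<close>, the intersection of the images lies almost in both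
  \<open>A\<close> and \<open>B\<close>, hence is small; applying \<open>f\<close> returns to the
  intersection up to a small set.\<close>

lemma f_almost_disjoint:
  assumes A: "A \<subseteq> L" and B: "B \<subseteq> L" and small: "|A \<inter> B| <o kap"
  shows "|f A \<inter> f B| <o kap"
proof -
  let ?C = "f A \<inter> f B"
  have C: "?C \<subseteq> L" using f_subset[OF A] by blast
  have "g ?C \<lesssim> g (f A)" "g ?C \<lesssim> g (f B)"
    using C f_subset[OF A] f_subset[OF B] by (simp_all add: g_asub_iff subset_lesssim)
  then have "g ?C \<lesssim> A \<inter> B"
    using gf_asub[OF A] gf_asub[OF B] asub_Int[OF kap] lesssim_trans by meson
  then have "|g ?C| <o kap" using kap small by (rule asub_small)
  then have "|f (g ?C)| <o kap" using g_subset[OF C] by (intro f_small)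
  with asub_fg[OF C] kap show ?thesis by (rule asub_small)
qed

text \<open>Applying \<open>g\<close> to \<open>fA\<close> shows that \<open>g U\<close> is an
  almost upper bound of the \<open>A i\<close>. Leastness gives \<open>U \<lesssim> g U\<close>, and
  applying \<open>f\<close> gives the claim.\<close>

lemma f_lub_asub:
  assumes U: "U \<subseteq> L" and A: "\<And>i. i \<in> I \<Longrightarrow> A i \<subseteq> L"
    and least: "\<And>C. (\<And>i. i \<in> I \<Longrightarrow> A i \<lesssim> C) \<Longrightarrow> U \<lesssim> C"
    and fA: "\<And>i. i \<in> I \<Longrightarrow> f (A i) \<lesssim> U"
  shows "f U \<lesssim> U"
proof -
  have "A i \<lesssim> g U" if "i \<in> I" for i
    using g_mono[OF f_subset[OF A[OF that]] U fA[OF that]] asub_gf[OF A[OF that]] lesssim_trans by blast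
  then have "U \<lesssim> g U" by (rule least)
  then have "f U \<lesssim> f (g U)" using U g_subset by (simp add: f_mono)
  with fg_asub[OF U] show ?thesis using lesssim_trans by blast
qed

section \<open>Representatives of fixed points, their unions, and closure under both maps\<close>

definition almost_fixed :: "'a set \<Rightarrow> bool" where
  "almost_fixed A \<longleftrightarrow> A \<subseteq> L \<and> f A \<lesssim> A \<and> A \<lesssim> f A"

text \<open>This form is symmetric in \<open>f\<close> and \<open>g\<close> and turns being fixed
  into a closure condition.\<close>

lemma almost_fixed_iff: "almost_fixed A \<longleftrightarrow> A \<subseteq> L \<and> f A \<lesssim> A \<and> g A \<lesssim> A"
proof -
  have "A \<lesssim> f A \<longleftrightarrow> g A \<lesssim> A" if "A \<subseteq> L"
    using that g_asub_iff[of A "f A"] f_subset[of A] gf_asub asub_gf lesssim_trans by meson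
  then show ?thesis unfolding almost_fixed_def by blast
qed

text \<open>Asking only that the images of the \<open>A i\<close> lie almost in \<open>U\<close>
  covers both unions of fixed points and the stages of a closure construction.\<close>

lemma almost_fixed_lub:
  assumes "U \<subseteq> L" and "\<And>i. i \<in> I \<Longrightarrow> A i \<subseteq> L"
    and "\<And>C. (\<And>i. i \<in> I \<Longrightarrow> A i \<lesssim> C) \<Longrightarrow> U \<lesssim> C"
    and "\<And>i. i \<in> I \<Longrightarrow> f (A i) \<lesssim> U" and "\<And>i. i \<in> I \<Longrightarrow> g (A i) \<lesssim> U"
  shows "almost_fixed U"
  unfolding almost_fixed_iff
proof (intro conjI)
  show "f U \<lesssim> U" by (rule f_lub_asub[of U I A]) (fact assms)+
  show "g U \<lesssim> U" by (rule almost_automorphism.f_lub_asub[OF inverse, of U I A]) (fact assms)+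
qed (fact assms)

lemma almost_fixed_UN:
  assumes A: "\<And>i. i \<in> I \<Longrightarrow> almost_fixed (A i)"
    and least: "\<And>C. (\<And>i. i \<in> I \<Longrightarrow> A i \<lesssim> C) \<Longrightarrow> (\<Union>i\<in>I. A i) \<lesssim> C"
  shows "almost_fixed (\<Union>i\<in>I. A i)"
proof -
  have A': "A i \<subseteq> L" "f (A i) \<lesssim> A i" "g (A i) \<lesssim> A i" if "i \<in> I" for i
    using A[OF that] unfolding almost_fixed_iff by blast+
  have AU: "A i \<lesssim> (\<Union>i\<in>I. A i)" if "i \<in> I" for i using that by (intro subset_lesssim) blast
  show ?thesis
  proof (rule almost_fixed_lub[of _ I A])
    show "(\<Union>i\<in>I. A i) \<subseteq> L" using A'(1) by blast
    show "f (A i) \<lesssim> (\<Union>i\<in>I. A i)" "g (A i) \<lesssim> (\<Union>i\<in>I. A i)" if "i \<in> I" for i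
      using lesssim_trans[OF A'(2) AU] lesssim_trans[OF A'(3) AU] that by blast+
  qed (fact A'(1) least)+
qed

text \<open>Stage \<open>b\<close> of a recursion along \<open>eta\<close> collects \<open>A\<close>
  and all earlier stages with their images. The stages increase, so their union is a least upper
  bound with respect to \<open>\<lesssim>\<close> by the choice of \<open>eta\<close>. At most
  \<open>theta\<close> stages of size at most \<open>theta\<close> keep the size under
  control.\<close>

lemma almost_fixed_closure:
  fixes eta :: "'c rel" and theta :: "'d rel"
  assumes eta: "Cinfinite eta" "regularCard eta" and neq: "\<not> eta =o cf kap"
    and theta: "Cinfinite theta" "eta \<le>o theta"
    and f: "\<And>X. X \<subseteq> L \<Longrightarrow> |X| \<le>o theta \<Longrightarrow> |f X| \<le>o theta"
    and g: "\<And>X. X \<subseteq> L \<Longrightarrow> |X| \<le>o theta \<Longrightarrow> |g X| \<le>o theta"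
    and A: "A \<subseteq> L" "|A| \<le>o theta"
  obtains B where "almost_fixed B" and "A \<subseteq> B" and "|B| \<le>o theta"
proof -
  have We: "Well_order eta" using eta Cinfinite_Well_order by blast
  then interpret wo_rel eta by (rule wo_rel.intro)
  have Fe: "|Field eta| \<le>o theta"
    using ordIso_ordLeq_trans[OF card_of_Field_ordIso theta(2)] eta(1) by blast
  define H where "H = (\<lambda>(X :: 'c \<Rightarrow> 'a set) b. A \<union> (\<Union>a\<in>underS b. X a \<union> f (X a) \<union> g (X a)))"
  define S where "S = worec H"
  have "adm_wo H" unfolding adm_wo_def H_def by auto
  then have "S = H S" unfolding S_def by (rule worec_fixpoint)
  then have S: "S b = A \<union> (\<Union>a\<in>underS b. S a \<union> f (S a) \<union> g (S a))" for b
    unfolding H_def by (rule fun_cong)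
  have SL: "S b \<subseteq> L \<and> |S b| \<le>o theta" for b
  proof (induction b rule: well_order_induct)
    case (1 b)
    then have IH: "S a \<subseteq> L" "|S a| \<le>o theta" if "a \<in> underS b" for a
      using that by (auto simp: underS_def)
    have "|underS b| \<le>o |Field eta|" by (intro card_of_mono1 Order_Relation.underS_Field)
    then have "|underS b| \<le>o theta" using Fe by (rule ordLeq_transitive)
    then have "|\<Union>a\<in>underS b. S a \<union> f (S a) \<union> g (S a)| \<le>o theta"
      using IH f g theta(1) by (intro UNION_Cinfinite_bound ballI Un_Cinfinite_bound) auto
    then have "|S b| \<le>o theta"
      unfolding S[of b] using A(2) theta(1) by (intro Un_Cinfinite_bound)
    moreover have "S b \<subseteq> L"
      unfolding S[of b] using A(1) IH(1) f_subset[OF IH(1)] g_subset[OF IH(1)]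
      by (intro Un_least UN_least)
    ultimately show ?case by blast
  qed
  define B where "B = (\<Union>b\<in>Field eta. S b)"
  have step: "f (S a) \<subseteq> B" "g (S a) \<subseteq> B" if a: "a \<in> Field eta" for a
  proof -
    \<comment> \<open>As \<open>eta\<close> has no last element, a later stage absorbs the images of
      stage \<open>a\<close>.\<close>
    obtain b where "b \<in> Field eta" "a \<in> underS b"
      using infinite_Card_order_limit[of eta a] eta a by (auto simp: cinfinite_def underS_def)
    then show "f (S a) \<subseteq> B" "g (S a) \<subseteq> B" unfolding B_def using S[of b] by auto
  qed
  have "almost_fixed B"
  proof (rule almost_fixed_lub[of _ "Field eta" S])
    fix C assume "\<And>i. i \<in> Field eta \<Longrightarrow> S i \<lesssim> C"
    moreover have "(\<Union>a\<in>underS b. S a) \<lesssim> S b" for b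
      using S[of b] by (intro subset_lesssim) blast
    ultimately show "B \<lesssim> C"
      unfolding B_def by (intro UN_asub_if_almost_chain[OF kap eta neq])
  next
    show "f (S i) \<lesssim> B" "g (S i) \<lesssim> B" if "i \<in> Field eta" for i
      using step[OF that] by (auto intro: subset_lesssim)
  qed (use SL in \<open>auto simp: B_def\<close>)
  moreover have "Field eta \<noteq> {}" using eta by (auto simp: cinfinite_def)
  then have "A \<subseteq> B" unfolding B_def using S by blast
  moreover have "|B| \<le>o theta"
    unfolding B_def using Fe SL theta(1) by (intro UNION_Cinfinite_bound) auto
  ultimately show thesis by (rule that)
qed

end

section \<open>Sizes of images for regular \<open>\<kappa>\<close>\<close>

text \<open>From here on \<open>|X|\<close> also serves as a well-order of \<open>X\<close> of least
  possible type, so its proper initial segments are smaller than \<open>X\<close>.\<close>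

lemma underS_card_of_ordLess: "|underS |X| x| <o r" if "x \<in> X" "|X| \<le>o r" for X :: "'a set"
  using card_of_underS[OF card_of_Card_order, of x X] that
  by (simp add: Field_card_of ordLess_ordLeq_trans)

lemma under_card_of_ordLess:
  assumes "Cinfinite r" and "x \<in> X" "|X| \<le>o r"
  shows "|under |X| x| <o r"
proof -
  have "|underS |X| x \<union> {x}| <o r"
  proof (rule Un_Cinfinite_bound_strict)
    show "|{x}| <o r" using assms(1) by (intro Cinfinite_finite_ordLess) simp
  qed (fact underS_card_of_ordLess[OF assms(2,3)] assms(1))+
  then show ?thesis by (rule ordLess_mono[rotated]) (auto simp: under_def underS_def)
qed

text \<open>If \<open>F\<close> were larger than \<open>r\<close>, the order induced on
  \<open>F\<close> would be longer than \<open>r\<close>, so some \<open>a\<close> in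
  \<open>F\<close> would have \<open>r\<close> many predecessors in \<open>F\<close>.\<close>

lemma card_of_ordLeq_if_initial_segments_small:
  assumes r: "Card_order r" and F: "F \<subseteq> X" and small: "\<And>x. x \<in> X \<Longrightarrow> |F \<inter> underS |X| x| <o r"
  shows "|F| \<le>o r"
proof (rule ccontr)
  assume neg: "\<not> ?thesis"
  have Wr: "Well_order r" using r by (auto simp: card_order_on_def)
  then have "r <o |F|"
using neg not_ordLeq_iff_ordLess[OF Wr card_of_Well_order] by blast
  let ?s = "Restr |X| F"
  have Ws: "Well_order ?s" using card_of_Well_order by (rule Well_order_Restr)
  have Fs: "Field ?s = F"
    using F card_of_Well_order[of X] Refl_Field_Restr2[of "|X|" F]
    by (auto simp: Field_card_of order_on_defs)
  have "|F| \<le>o ?s" using card_of_least[of F ?s] Ws Fs by simp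
  with \<open>r <o |F|\<close> have "r <o ?s" by (rule ordLess_ordLeq_trans)
  then obtain a where a: "a \<in> F" and iso: "r =o Restr ?s (underS ?s a)"
    using ordLess_iff_ordIso_Restr[OF Ws Wr] Fs by blast
  have "Field (Restr ?s (underS ?s a)) = underS ?s a"
    using Ws by (simp add: Field_Restr_ofilter wo_rel.underS_ofilter wo_rel_def)
  then have "|Field r| =o |underS ?s a|" using card_of_cong[OF iso] by simp
  then have "r =o |underS ?s a|"
    using ordIso_transitive[OF ordIso_symmetric[OF card_of_Field_ordIso[OF r]]] by blast
  moreover have "|underS ?s a| <o r"
    by (rule ordLess_mono[OF _ small]) (use a F in \<open>auto simp: underS_def\<close>)
  ultimately show False using not_ordLess_ordIso ordIso_symmetric by blast
qed

context almost_automorphism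
begin

text \<open>
  The argument of Balcar and Frankiewicz: if \<open>|f X| > kap\<^sup>+\<close>, put a grid \<open>kap \<times> Z\<close> with
  \<open>|Z| > kap\<^sup>+\<close> into \<open>f X\<close> and pull its columns back to disjoint subsets \<open>v n\<close> of \<open>X\<close>.
  Any \<open>kap\<^sup>+\<close> rows of the grid give a dominating family of size \<open>kap\<^sup>+\<close> among the functions
  choosing a point of each \<open>v n\<close>, while the rows missed by all members of this family give
  a function dominating all of them.
\<close>

lemma card_f_ordLeq_cardSuc:
  assumes reg: "regularCard kap" and X: "X \<subseteq> L" "|X| \<le>o kap"
  shows "|f X| \<le>o cardSuc kap"
proof (rule ccontr)
  assume neg: "\<not> |f X| \<le>o cardSuc kap"
  define Z where "Z = f X"
  have ZL: "Z \<subseteq> L" unfolding Z_def using X(1) by (rule f_subset)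
  have Ck: "Card_order kap" and Wk: "Well_order kap" using kap Cinfinite_Well_order by blast+
  have Csuc: "Card_order (cardSuc kap)" using Ck by (rule cardSuc_Card_order)
  have Isuc: "Cinfinite (cardSuc kap)" using kap by (rule Cinfinite_cardSuc)
  have k_suc: "kap <o cardSuc kap" using Ck by (rule cardSuc_greater)
  have suc_Z: "cardSuc kap <o |Z|"
    using neg not_ordLeq_iff_ordLess[OF card_order_on_well_order_on[OF Csuc] card_of_Well_order]
    unfolding Z_def by blast
  have k_Z: "kap <o |Z|" using k_suc suc_Z by (rule ordLess_transitive)
  have Fk: "|Field kap| =o kap" using Ck by (rule card_of_Field_ordIso)
  have UN_small: "|\<Union>i\<in>I. A i| <o kap" if "|I| <o kap" "\<And>i. i \<in> I \<Longrightarrow> |A i| <o kap"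
    for I :: "'b set" and A :: "'b \<Rightarrow> 'a set"
    using card_of_UNION_ordLess_infinite_Field_regularCard[OF reg kap that(1)] that(2) by blast

  \<comment> \<open>Since \<open>kap <o |Z|\<close>, the grid embeds into \<open>Z\<close> itself;
    \<open>h (n, z)\<close> is its point in column \<open>n\<close> and row
    \<open>z\<close>.\<close>
  have "|Field kap \<times> Z| \<le>o |Z|"
  proof (rule card_of_Times_ordLeq_infinite_Field[of "|Z|" "Field kap" Z, unfolded Field_card_of])
    show "infinite Z"
      using kap k_Z by (metis Field_card_of cinfinite_def cinfinite_mono ordLess_imp_ordLeq)
    show "|Field kap| \<le>o |Z|" using Fk ordLess_imp_ordLeq[OF k_Z] by (rule ordIso_ordLeq_trans)
  qed (simp_all add: card_of_Card_order[of Z, unfolded Field_card_of] ordLeq_refl card_of_Card_order)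
  then obtain h where h: "inj_on h (Field kap \<times> Z)" "h ` (Field kap \<times> Z) \<subseteq> Z"
    using card_of_ordLeq[of "Field kap \<times> Z" Z] by blast
  have h_eq: "h (n, z) = h (m, w) \<longleftrightarrow> n = m \<and> z = w"
    if "n \<in> Field kap" "m \<in> Field kap" "z \<in> Z" "w \<in> Z" for n m z w
    using inj_onD[OF h(1), of "(n, z)" "(m, w)"] that by auto
  have h_Z: "h (n, z) \<in> Z" if "n \<in> Field kap" "z \<in> Z" for n z using h(2) that by blast

  define V where "V n = (\<lambda>z. h (n, z)) ` Z" for n
  have V_Z: "V n \<subseteq> Z" if "n \<in> Field kap" for n unfolding V_def using h_Z that by blast
  have V_L: "V n \<subseteq> L" if "n \<in> Field kap" for n using V_Z[OF that] ZL by blast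
  \<comment> \<open>The pull-back of column \<open>n\<close>, cut down to \<open>X\<close> and made
    disjoint from the pull-backs of earlier columns. Fewer than \<open>kap\<close> small sets are
    removed, so by regularity of \<open>kap\<close> little is lost.\<close>
  define v where "v n = (g (V n) \<inter> X) - (\<Union>m\<in>underS kap n. g (V m))" for n
  have v_disj: "n = m" if "n \<in> Field kap" "m \<in> Field kap" "x \<in> v n" "x \<in> v m" for n m x
    using wo_rel.TOTALS[OF wo_rel.intro[OF Wk]] that unfolding v_def underS_def by blast
  have V_v: "g (V n) \<lesssim> v n" if n: "n \<in> Field kap" for n
  proof -
    have "g (V n) \<lesssim> g (f X)"
      using V_L[OF n] V_Z[OF n] f_subset[OF X(1)] unfolding Z_def[symmetric]
      by (intro g_mono subset_lesssim)
    then have "|g (V n) - X| <o kap"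
      using lesssim_trans[OF _ gf_asub[OF X(1)]] unfolding asub_def by blast
    moreover have "|\<Union>m\<in>underS kap n. g (V n) \<inter> g (V m)| <o kap"
    proof (rule UN_small)
      fix m assume m: "m \<in> underS kap n"
      then have m': "m \<in> Field kap" "m \<noteq> n" by (auto simp: underS_def Field_def)
      then have "V n \<inter> V m = {}" unfolding V_def using n h_eq by auto
      then show "|g (V n) \<inter> g (V m)| <o kap"
        using almost_automorphism.f_almost_disjoint[OF inverse V_L[OF n] V_L[OF m'(1)]]
          Cinfinite_finite_ordLess[OF finite.emptyI kap] by simp
    qed (rule card_of_underS[OF Ck n])
    ultimately have "|(g (V n) - X) \<union> (\<Union>m\<in>underS kap n. g (V n) \<inter> g (V m))| <o kap"
      using kap by (intro Un_Cinfinite_bound_strict)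
    then show ?thesis
      unfolding asub_def by (rule ordLess_mono[rotated]) (auto simp: v_def)
  qed

  \<comment> \<open>\<open>G t\<close> is the region on or below the graph of \<open>t\<close> in
    the order \<open>|X|\<close>, and \<open>P t\<close> is the set of rows that
    \<open>f (G t)\<close> meets.\<close>
  define G where "G t = {x. \<exists>n\<in>Field kap. x \<in> v n \<and> (x, t n) \<in> |X| }" for t
  define P where "P t = {z\<in>Z. \<exists>n\<in>Field kap. h (n, z) \<in> f (G t)}" for t
  have G_X: "G t \<subseteq> X" for t unfolding G_def v_def by blast
  have G_L: "G t \<subseteq> L" for t using G_X X(1) by blast
  \<comment> \<open>In each \<open>v n\<close> the region lies in an initial segment of size less
    than \<open>kap\<close>, so its image meets each of the \<open>kap\<close> columns in fewer than
    \<open>kap\<close> points.\<close>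
  have card_P: "|P t| \<le>o kap" for t
  proof -
    have "|f (G t) \<inter> V n| <o kap" if n: "n \<in> Field kap" for n
    proof -
      have sub: "G t \<inter> v n \<subseteq> under |X| (t n)"
        using v_disj n unfolding G_def under_def by blast
      have "|G t \<inter> v n| <o kap"
      proof (cases "t n \<in> X")
        case True
        show ?thesis by (rule ordLess_mono[OF sub under_card_of_ordLess[OF kap True X(2)]])
      next
        \<comment> \<open>For a value \<open>t n\<close> outside \<open>X\<close> nothing lies below
          it, so the region misses \<open>v n\<close>.\<close>
        case False
        then have "under |X| (t n) = {}" unfolding under_def
          by (metis (mono_tags, lifting) FieldI2 Field_card_of empty_Collect_eq)
        then show ?thesis using sub Cinfinite_finite_ordLess[OF finite.emptyI kap] by simp
      qed
      moreover have "G t \<inter> g (V n) \<lesssim> G t \<inter> v n"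
        using V_v[OF n] unfolding asub_def by (rule ordLess_mono[rotated]) blast
      ultimately have "|G t \<inter> g (V n)| <o kap" using asub_small kap by blast
      then have "|f (G t) \<inter> f (g (V n))| <o kap"
        using f_almost_disjoint[OF G_L g_subset[OF V_L[OF n]]] by blast
      moreover have "f (G t) \<inter> V n \<lesssim> f (G t) \<inter> f (g (V n))"
        using asub_fg[OF V_L[OF n]] unfolding asub_def by (rule ordLess_mono[rotated]) blast
      ultimately show ?thesis using asub_small kap by blast
    qed
    then have "|\<Union>n\<in>Field kap. f (G t) \<inter> V n| \<le>o kap"
      using kap Fk by (intro UNION_Cinfinite_bound) (auto intro: ordLess_imp_ordLeq ordIso_imp_ordLeq)
    moreover define p where "p x = snd (inv_into (Field kap \<times> Z) h x)" for x
    have "P t \<subseteq> p ` (\<Union>n\<in>Field kap. f (G t) \<inter> V n)"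
    proof
      fix z assume "z \<in> P t"
      then obtain n where n: "n \<in> Field kap" "z \<in> Z" "h (n, z) \<in> f (G t)" unfolding P_def by blast
      then have "p (h (n, z)) = z" unfolding p_def using h(1) by simp
      moreover have "h (n, z) \<in> f (G t) \<inter> V n" using n unfolding V_def by blast
      ultimately show "z \<in> p ` (\<Union>n\<in>Field kap. f (G t) \<inter> V n)" using n(1) by (metis UN_I image_eqI)
    qed
    then have "|P t| \<le>o |\<Union>n\<in>Field kap. f (G t) \<inter> V n|" by (rule surj_imp_ordLeq)
    ultimately show ?thesis by (rule ordLeq_transitive[rotated])
  qed

  \<comment> \<open>\<open>E Q\<close> is \<open>Z\<close> without the rows in \<open>Q\<close>. If
    \<open>v n\<close> were inside \<open>g (E Q)\<close>, column \<open>n\<close> would lie almost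
    in \<open>E Q\<close>, although it has at least \<open>kap\<close> points in the rows of
    \<open>Q\<close>. So \<open>t Q\<close> can choose points of the \<open>v n\<close> outside
    \<open>g (E Q)\<close>.\<close>
  define E where "E Q = Z - h ` (Field kap \<times> Q)" for Q
  have E_L: "E Q \<subseteq> L" for Q unfolding E_def using ZL by blast
  have "\<exists>x. x \<in> v n - g (E Q)" if Q: "Q \<subseteq> Z" "kap \<le>o |Q|" and n: "n \<in> Field kap" for Q n
  proof (rule ccontr)
    assume "\<not> ?thesis"
    then have "v n \<lesssim> g (E Q)" by (intro subset_lesssim) blast
    with V_v[OF n] have "g (V n) \<lesssim> g (E Q)" by (rule lesssim_trans)
    then have "V n \<lesssim> E Q" using g_asub_iff[OF V_L[OF n] E_L] by blast
    then have "|V n - E Q| <o kap" unfolding asub_def .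
    moreover have "(\<lambda>z. h (n, z)) ` Q \<subseteq> V n - E Q"
      unfolding V_def E_def using Q(1) n by blast
    moreover have "|Q| \<le>o |(\<lambda>z. h (n, z)) ` Q|"
      using h_eq[OF n n] Q(1) by (intro card_of_ordLeqI[of "\<lambda>z. h (n, z)"] inj_onI) (blast+)
    ultimately have "|Q| <o kap" using ordLess_mono ordLeq_ordLess_trans by metis
    then show False using Q(2) not_ordLess_ordLeq by blast
  qed
  then obtain t where t: "\<And>Q n. Q \<subseteq> Z \<Longrightarrow> kap \<le>o |Q| \<Longrightarrow> n \<in> Field kap \<Longrightarrow> t Q n \<in> v n - g (E Q)"
    by metis

  \<comment> \<open>If \<open>f (G s)\<close> misses the rows of \<open>Q\<close>, then
    \<open>G s\<close> lies almost in \<open>g (E Q)\<close>. The points \<open>t Q n\<close> avoid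
    that set and are distinct, so fewer than \<open>kap\<close> of them lie on or below the graph of
    \<open>s\<close>.\<close>
  have dominates: "|{n\<in>Field kap. (t Q n, s n) \<in> |X| }| <o kap"
    if Q: "Q \<subseteq> Z" "kap \<le>o |Q|" and PQ: "P s \<inter> Q = {}" for Q s
  proof -
    have "f (G s) \<lesssim> Z"
      unfolding Z_def using G_L X(1) G_X by (intro f_mono subset_lesssim)
    moreover have "f (G s) \<inter> Z \<subseteq> E Q"
      unfolding E_def using PQ Q(1) unfolding P_def by blast
    then have "f (G s) - E Q \<subseteq> f (G s) - Z" by blast
    ultimately have "f (G s) \<lesssim> E Q" unfolding asub_def using ordLess_mono by blast
    then have "g (f (G s)) \<lesssim> g (E Q)" using f_subset[OF G_L] E_L by (intro g_mono)
    then have "G s \<lesssim> g (E Q)" using asub_gf[OF G_L] lesssim_trans by blast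
    then have small: "|G s - g (E Q)| <o kap" unfolding asub_def .
    let ?N = "{n\<in>Field kap. (t Q n, s n) \<in> |X| }"
    have "inj_on (t Q) ?N"
      using t[OF Q] v_disj by (intro inj_onI) (metis (no_types, lifting) DiffD1 mem_Collect_eq)
    moreover have "t Q ` ?N \<subseteq> G s - g (E Q)"
      using t[OF Q] unfolding G_def by blast
    ultimately have "|?N| \<le>o |G s - g (E Q)|" by (intro card_of_ordLeqI[of "t Q"]) blast+
    then show ?thesis using small by (rule ordLeq_ordLess_trans)
  qed

  obtain Z1 where Z1: "Z1 \<subseteq> Z" "|Z1| =o cardSuc kap"
    by (rule subset_of_size[OF Csuc ordLess_imp_ordLeq[OF suc_Z]])
  let ?I = "\<lambda>i. underS |Z1| i"
  have big: "kap \<le>o |Y - W|" if "cardSuc kap \<le>o |Y|" "|W| \<le>o kap" for Y W :: "'a set"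
  proof (rule ccontr)
    assume "\<not> ?thesis"
    then have "|Y - W| \<le>o kap"
      using not_ordLeq_iff_ordLess[OF card_of_Well_order Wk] ordLess_imp_ordLeq by blast
    then have "|(Y - W) \<union> W| \<le>o kap" using that(2) kap by (rule Un_Cinfinite_bound)
    then have "|Y| \<le>o kap" using ordLeq_transitive[OF card_of_mono1[of Y "(Y - W) \<union> W"]] by blast
    with that(1) have "cardSuc kap \<le>o kap" by (rule ordLeq_transitive)
    with k_suc show False using not_ordLess_ordLeq by blast
  qed
  \<comment> \<open>The dominating family: the functions belonging to the tails of
    \<open>Z1\<close>, a set of \<open>kap\<^sup>+\<close> rows.\<close>
  define q where "q i = t (Z1 - ?I i)" for i
  have Zi: "Z1 - ?I i \<subseteq> Z" "kap \<le>o |Z1 - ?I i|" if "i \<in> Z1" for i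
  proof -
    have "|?I i| <o cardSuc kap" using underS_card_of_ordLess[OF that ordIso_imp_ordLeq[OF Z1(2)]] .
    then have "|?I i| \<le>o kap" using cardSuc_ordLeq_ordLess[OF Ck card_of_Card_order] by blast
    then show "kap \<le>o |Z1 - ?I i|"
      using big ordIso_imp_ordLeq[OF ordIso_symmetric[OF Z1(2)]] by blast
  qed (use Z1 in blast)
  \<comment> \<open>\<open>W\<close> contains all rows met by the family, at most
    \<open>kap\<^sup>+\<close> many. The remaining rows \<open>Q\<close> are numerous enough for
    \<open>t Q\<close> to exist, and \<open>t Q\<close> dominates every \<open>q i\<close>.\<close>
  define W where "W = (\<Union>i\<in>Z1. P (q i))"
  have W: "|W| \<le>o cardSuc kap"
    unfolding W_def using Isuc ordIso_imp_ordLeq[OF Z1(2)] 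
      ordLeq_transitive[OF card_P ordLess_imp_ordLeq[OF k_suc]]
    by (intro UNION_Cinfinite_bound) auto
  define Q where "Q = Z - W"
  have "kap \<le>o |Q|"
  proof (rule ccontr)
    assume "\<not> ?thesis"
    then have "|Q| \<le>o cardSuc kap"
      using not_ordLeq_iff_ordLess[OF card_of_Well_order Wk] ordLess_imp_ordLeq
        ordLess_transitive[OF _ k_suc] by blast
    then have "|Q \<union> W| \<le>o cardSuc kap" using W Isuc by (rule Un_Cinfinite_bound)
    then have "|Z| \<le>o cardSuc kap"
      using ordLeq_transitive[OF card_of_mono1[of Z "Q \<union> W"]] unfolding Q_def by blast
    with suc_Z show False using not_ordLess_ordLeq by blast
  qed
  moreover have "Q \<subseteq> Z" unfolding Q_def by blast
  ultimately have Q: "Q \<subseteq> Z" "kap \<le>o |Q|" by blast+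
  \<comment> \<open>Conversely, the at most \<open>kap\<close> rows of \<open>P (t Q)\<close> are
    bounded in \<open>Z1\<close> by regularity of \<open>kap\<^sup>+\<close>, so \<open>q i\<close>
    for a later \<open>i\<close> dominates \<open>t Q\<close>.\<close>
  obtain i where i: "i \<in> Z1" "P (t Q) \<inter> Z1 \<subseteq> ?I i"
  proof -
    have reg1: "Cinfinite |Z1|" "regularCard |Z1|"
      using Cinfinite_cong regularCard_ordIso ordIso_symmetric[OF Z1(2)] Isuc
        regularCard_cardSuc[OF kap] by blast+
    have "|P (t Q) \<inter> Z1| \<le>o |P (t Q)|" by (rule card_of_mono1) blast
    also have "|P (t Q)| \<le>o kap" by (rule card_P)
    also note k_suc
    also note ordIso_symmetric[OF Z1(2)]
    finally have "|P (t Q) \<inter> Z1| <o |Z1|" .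
    then obtain a where a: "a \<in> Z1" "\<And>k. k \<in> P (t Q) \<inter> Z1 \<Longrightarrow> (k, a) \<in> |Z1|"
      using bounded_if_ordLess_regularCard[OF reg1, of "P (t Q) \<inter> Z1"] by (auto simp: Field_card_of)
    obtain b where b: "b \<in> Z1" "a \<noteq> b" "(a, b) \<in> |Z1|"
      using infinite_Card_order_limit[of "|Z1|" a] reg1(1) a(1) by (auto simp: cinfinite_def Field_card_of)
    have "P (t Q) \<inter> Z1 \<subseteq> ?I b"
    proof
      fix k assume "k \<in> P (t Q) \<inter> Z1"
      then have "(k, a) \<in> |Z1|" by (rule a(2))
      then have "k \<in> under |Z1| a" by (simp add: under_def)
      then show "k \<in> ?I b"
        using b card_of_Well_order[of Z1] 
        by (smt (verit, best) antisymD mem_Collect_eq order_on_defs transD under_def underS_def)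
    qed
    with b(1) show thesis by (rule that)
  qed
  \<comment> \<open>Two functions cannot dominate each other: at each \<open>n\<close> their values
    are comparable, so one of two small sets contains \<open>n\<close>.\<close>
  let ?A = "{n\<in>Field kap. (q i n, t Q n) \<in> |X| }" and ?B = "{n\<in>Field kap. (t Q n, q i n) \<in> |X| }"
  have "P (t Q) \<inter> (Z1 - ?I i) = {}" using i(2) by blast
  then have A: "|?A| <o kap" unfolding q_def by (rule dominates[OF Zi[OF i(1)]])
  have "P (q i) \<inter> Q = {}" unfolding Q_def W_def using i(1) by blast
  then have B: "|?B| <o kap" by (rule dominates[OF Q])
  have "|?A \<union> ?B| <o kap" using A B kap by (rule Un_Cinfinite_bound_strict)
  moreover have "Field kap \<subseteq> ?A \<union> ?B"
  proof
    fix n assume n: "n \<in> Field kap"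
    have "q i n \<in> X" "t Q n \<in> X"
      using t[OF Zi[OF i(1)] n] t[OF Q n] unfolding q_def v_def by blast+
    then show "n \<in> ?A \<union> ?B"
      using n wo_rel.TOTALS[OF wo_rel.intro[OF card_of_Well_order[of X]]] by (auto simp: Field_card_of)
  qed
  ultimately have "|Field kap| <o kap" by (rule ordLess_mono[rotated])
  with Fk show False using not_ordLess_ordIso by blast
qed

text \<open>Induction on the cardinal of \<open>X\<close>. The lemma
  \<open>card_f_ordLeq_cardSuc\<close> settles \<open>|X| \<le>o kap\<close> and also bounds the
  image of the residual set \<open>F\<close> in the other case.\<close>

lemma card_f_ordLeq:
  assumes reg: "regularCard kap"
  shows "X \<subseteq> L \<Longrightarrow> |f X| \<le>o |X| +c cardSuc kap"
proof (induction "|X|" arbitrary: X rule: wf_induct_rule[OF wf_ordLess])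
  case (1 X)
  have Ck: "Card_order kap" and Wk: "Well_order kap" using kap Cinfinite_Well_order by blast+
  have Isuc: "Cinfinite (cardSuc kap)" using kap by (rule Cinfinite_cardSuc)
  show ?case
  proof (cases "|X| \<le>o kap")
    case True
    show ?thesis
      using card_f_ordLeq_cardSuc[OF reg 1(2) True] ordLeq_csum2[OF conjunct2[OF Isuc]]
      by (rule ordLeq_transitive)
  next
    case False
    then have "kap <o |X|"
      using not_ordLeq_iff_ordLess[OF Wk card_of_Well_order] by blast
    then have suc_X: "cardSuc kap \<le>o |X|" using cardSuc_least[OF Ck card_of_Card_order] by blast
    have CX: "Cinfinite |X|"
      using cinfinite_mono[OF suc_X] Isuc card_of_Card_order by blast
    let ?I = "\<lambda>x. underS |X| x"
    have I_X: "?I x \<subseteq> X" for x using Order_Relation.underS_Field[of "|X|" x] by (simp add: Field_card_of)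
    have I_L: "?I x \<subseteq> L" for x using I_X 1(2) by (rule order_trans)
    \<comment> \<open>The induction hypothesis bounds the images of proper initial segments of \<open>X\<close>. What is
      left of \<open>f X\<close> comes from a subset of \<open>X\<close> meeting each of them in fewer than \<open>kap\<close>
      points, which hence has at most \<open>kap\<close> points.\<close>
    define U where "U = (\<Union>x\<in>X. f (?I x))"
    have fI: "|f (?I x)| \<le>o |X|" if "x \<in> X" for x
    proof -
      have less: "|?I x| <o |X|"
        using card_of_underS[OF card_of_Card_order, of x X] that by (simp add: Field_card_of)
      have "|f (?I x)| \<le>o |?I x| +c cardSuc kap" using 1(1)[OF less I_L] .
      also have "|?I x| +c cardSuc kap \<le>o |X|"
        using ordLess_imp_ordLeq[OF less] suc_X card_of_Card_order cardSuc_Card_order[OF Ck] CX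
        by (intro csum_cinfinite_bound) auto
      finally show ?thesis .
    qed
    have U: "|U| \<le>o |X|"
      unfolding U_def using fI CX by (intro UNION_Cinfinite_bound) (auto simp: ordLeq_refl card_of_Card_order)
    define D where "D = f X - U"
    have D_L: "D \<subseteq> L" unfolding D_def using f_subset[OF 1(2)] by blast
    define F where "F = g D \<inter> X"
    have F_L: "F \<subseteq> L" unfolding F_def using 1(2) by blast
    have "|F \<inter> ?I x| <o kap" if x: "x \<in> X" for x
    proof -
      have "D \<inter> f (?I x) = {}" unfolding D_def U_def using x by blast
      then have "|g D \<inter> g (f (?I x))| <o kap"
        using almost_automorphism.f_almost_disjoint[OF inverse D_L f_subset[OF I_L[of x]]]
          Cinfinite_finite_ordLess[OF finite.emptyI kap] by simp
      moreover have "F \<inter> ?I x \<lesssim> g D \<inter> g (f (?I x))"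
        using asub_gf[OF I_L, of x] unfolding asub_def F_def by (rule ordLess_mono[rotated]) blast
      ultimately show ?thesis using asub_small kap by blast
    qed
    then have "|F| \<le>o kap"
      by (intro card_of_ordLeq_if_initial_segments_small[OF Ck, of F X]) (auto simp: F_def)
    then have "|f F| \<le>o cardSuc kap" by (rule card_f_ordLeq_cardSuc[OF reg F_L])
    then have "|f F| \<le>o |X|" using suc_X by (rule ordLeq_transitive)
    moreover have "D \<lesssim> f F"
    proof -
      have "g D \<lesssim> g (f X)"
        using D_L f_subset[OF 1(2)] by (intro g_mono subset_lesssim) (auto simp: D_def)
      then have "g D \<lesssim> X" using gf_asub[OF 1(2)] by (rule lesssim_trans)
      then have "g D \<lesssim> F" unfolding F_def asub_def by (rule ordLess_mono[rotated]) blast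
      then have "f (g D) \<lesssim> f F" using g_subset[OF D_L] F_L by (intro f_mono)
      with asub_fg[OF D_L] show ?thesis by (rule lesssim_trans)
    qed
    ultimately have "|D| \<le>o |X|"
      using ordLess_imp_ordLeq[OF \<open>kap <o |X|\<close>] CX by (intro asub_card_ordLeq[of kap D "f F"])
    then have "|D \<union> U| \<le>o |X|" using U CX by (rule Un_Cinfinite_bound)
    then have "|f X| \<le>o |X|"
      by (rule ordLeq_transitive[OF card_of_mono1, rotated]) (auto simp: D_def)
    also have "|X| \<le>o |X| +c cardSuc kap" using card_of_Card_order by (rule ordLeq_csum1)
    finally show ?thesis .
  qed
qed

end

section \<open>The quotient algebra\<close>

lemma asub_mono:
  assumes "Cinfinite kap" and "asub kap A C" and "asub kap B D" and "E - F \<subseteq> (A - C) \<union> (B - D)"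
  shows "asub kap E F"
  unfolding asub_def
  by (rule ordLess_mono[OF assms(4) Un_Cinfinite_bound_strict[OF assms(2,3)[unfolded asub_def] assms(1)]])

lemma in_cls_iff_asub:
  assumes "Cinfinite kap" and "A \<subseteq> Field lam"
  shows "C \<in> cls lam kap A \<longleftrightarrow> C \<subseteq> Field lam \<and> asub kap C A \<and> asub kap A C"
proof -
  have "|A - C \<union> (C - A)| <o kap \<longleftrightarrow> asub kap C A \<and> asub kap A C"
    using Un_Cinfinite_bound_strict[OF _ _ assms(1), of "A - C" "C - A"]
      ordLess_mono[of "A - C" "A - C \<union> (C - A)" kap] ordLess_mono[of "C - A" "A - C \<union> (C - A)" kap]
    unfolding asub_def by blast
  then show ?thesis using assms(2) by (auto simp: cls_def ideal_rel_def small_ideal_def)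
qed

lemma cls_eq_iff:
  assumes "Cinfinite kap" and "A \<subseteq> Field lam" and "B \<subseteq> Field lam"
  shows "cls lam kap A = cls lam kap B \<longleftrightarrow> asub kap A B \<and> asub kap B A"
proof
  assume "cls lam kap A = cls lam kap B"
  moreover have "A \<in> cls lam kap A"
    using assms(2) asub_subset[OF assms(1) subset_refl] by (simp add: in_cls_iff_asub[OF assms(1)])
  ultimately show "asub kap A B \<and> asub kap B A"
    using in_cls_iff_asub[OF assms(1,3)] by simp
next
  assume "asub kap A B \<and> asub kap B A"
  then have "asub kap C A \<and> asub kap A C \<longleftrightarrow> asub kap C B \<and> asub kap B C" for C
    using asub_trans[OF assms(1)] by metis
  then show "cls lam kap A = cls lam kap B"
    using assms by (simp add: set_eq_iff in_cls_iff_asub)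
qed

lemma cls_self: "Cinfinite kap \<Longrightarrow> A \<subseteq> Field lam \<Longrightarrow> A \<in> cls lam kap A"
  by (simp add: in_cls_iff_asub asub_subset)

lemma quot_eq: "quot lam kap = cls lam kap ` Pow (Field lam)"
  by (auto simp: quot_def quotient_def cls_def)

text \<open>Collapses the unions over representatives by which the quotient operations are
  defined.\<close>

lemma UN_cls_eq:
  assumes "x \<noteq> {}" and "\<And>A. A \<in> x \<Longrightarrow> h A = c"
  shows "(\<Union>A\<in>x. h A) = c"
  using assms by auto

lemma qmeet_cls:
  assumes "Cinfinite kap" and "A \<subseteq> Field lam" and "B \<subseteq> Field lam"
  shows "qmeet lam kap (cls lam kap A) (cls lam kap B) = cls lam kap (A \<inter> B)"
  unfolding qmeet_def
proof (intro UN_cls_eq)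
  fix C D assume "C \<in> cls lam kap A" "D \<in> cls lam kap B"
  then have C: "C \<subseteq> Field lam" "asub kap C A" "asub kap A C"
    and D: "D \<subseteq> Field lam" "asub kap D B" "asub kap B D"
    using assms by (simp_all add: in_cls_iff_asub)
  have "asub kap (C \<inter> D) (A \<inter> B)" "asub kap (A \<inter> B) (C \<inter> D)"
    by (rule asub_mono[OF assms(1) C(2) D(2)], blast) (rule asub_mono[OF assms(1) C(3) D(3)], blast)
  moreover have "C \<inter> D \<subseteq> Field lam" "A \<inter> B \<subseteq> Field lam" using C(1) assms(2) by blast+
  ultimately show "cls lam kap (C \<inter> D) = cls lam kap (A \<inter> B)"
    using cls_eq_iff[OF assms(1)] by blast
qed (use cls_self[OF assms(1)] assms in blast)+

lemma qjoin_cls: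
  assumes "Cinfinite kap" and "A \<subseteq> Field lam" and "B \<subseteq> Field lam"
  shows "qjoin lam kap (cls lam kap A) (cls lam kap B) = cls lam kap (A \<union> B)"
  unfolding qjoin_def
proof (intro UN_cls_eq)
  fix C D assume "C \<in> cls lam kap A" "D \<in> cls lam kap B"
  then have C: "C \<subseteq> Field lam" "asub kap C A" "asub kap A C"
    and D: "D \<subseteq> Field lam" "asub kap D B" "asub kap B D"
    using assms by (simp_all add: in_cls_iff_asub)
  have "asub kap (C \<union> D) (A \<union> B)" "asub kap (A \<union> B) (C \<union> D)"
    by (rule asub_mono[OF assms(1) C(2) D(2)], blast) (rule asub_mono[OF assms(1) C(3) D(3)], blast)
  moreover have "C \<union> D \<subseteq> Field lam" "A \<union> B \<subseteq> Field lam" using C(1) D(1) assms(2,3) by blast+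
  ultimately show "cls lam kap (C \<union> D) = cls lam kap (A \<union> B)"
    using cls_eq_iff[OF assms(1)] by blast
qed (use cls_self[OF assms(1)] assms in blast)+

lemma qcompl_cls:
  assumes "Cinfinite kap" and "A \<subseteq> Field lam"
  shows "qcompl lam kap (cls lam kap A) = cls lam kap (Field lam - A)"
  unfolding qcompl_def
proof (intro UN_cls_eq)
  fix C assume "C \<in> cls lam kap A"
  then have C: "C \<subseteq> Field lam" "asub kap C A" "asub kap A C"
    using assms by (simp_all add: in_cls_iff_asub)
  have "asub kap (Field lam - C) (Field lam - A)" "asub kap (Field lam - A) (Field lam - C)"
    by (rule asub_mono[OF assms(1) C(3) C(3)], blast) (rule asub_mono[OF assms(1) C(2) C(2)], blast)
  then show "cls lam kap (Field lam - C) = cls lam kap (Field lam - A)"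
    using cls_eq_iff[OF assms(1) Diff_subset Diff_subset] by blast
qed (use cls_self[OF assms(1)] assms in blast)

lemma qle_cls:
  assumes "Cinfinite kap" and "A \<subseteq> Field lam" and "B \<subseteq> Field lam"
  shows "qle lam kap (cls lam kap A) (cls lam kap B) \<longleftrightarrow> asub kap A B"
proof -
  have "A \<inter> B \<subseteq> Field lam" using assms(2) by blast
  then have "qle lam kap (cls lam kap A) (cls lam kap B) \<longleftrightarrow> asub kap (A \<inter> B) A \<and> asub kap A (A \<inter> B)"
    unfolding qle_def qmeet_cls[OF assms] by (simp add: cls_eq_iff assms)
  moreover have "asub kap (A \<inter> B) A" using assms(1) by (rule asub_subset) blast
  moreover have "asub kap A (A \<inter> B) \<longleftrightarrow> asub kap A B" unfolding asub_def by (simp add: Diff_Int2 Diff_Int)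
  ultimately show ?thesis by blast
qed

text \<open>\<open>f\<close> picks representatives of images and \<open>g\<close> of preimages,
  which exist by surjectivity. Order is expressed through meets, so it is preserved because meets
  are, and reflected by injectivity.\<close>

lemma automorphism_imp_almost_automorphism:
  assumes kap: "Cinfinite kap" and auto: "automorphism lam kap \<pi>"
  obtains f g where "almost_automorphism (Field lam) kap f g"
    and "\<And>A. A \<subseteq> Field lam \<Longrightarrow> \<pi> (cls lam kap A) = cls lam kap (f A)"
    and "\<And>A. A \<subseteq> Field lam \<Longrightarrow> \<pi> (cls lam kap (g A)) = cls lam kap A"
proof -
  let ?L = "Field lam" and ?c = "cls lam kap"
  have bij: "bij_betw \<pi> (quot lam kap) (quot lam kap)"
    and meet: "\<And>x y. x \<in> quot lam kap \<Longrightarrow> y \<in> quot lam kap \<Longrightarrow>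
      \<pi> (qmeet lam kap x y) = qmeet lam kap (\<pi> x) (\<pi> y)"
    using auto unfolding automorphism_def by blast+
  have cls_quot: "?c A \<in> quot lam kap" if "A \<subseteq> ?L" for A using that by (auto simp: quot_eq)
  have "\<exists>B. B \<subseteq> ?L \<and> \<pi> (?c A) = ?c B" if "A \<subseteq> ?L" for A
    using bij_betwE[OF bij, rule_format, OF cls_quot[OF that]] by (auto simp: quot_eq)
  then obtain f where f: "\<And>A. A \<subseteq> ?L \<Longrightarrow> f A \<subseteq> ?L" "\<And>A. A \<subseteq> ?L \<Longrightarrow> \<pi> (?c A) = ?c (f A)"
    by metis
  have "\<exists>B. B \<subseteq> ?L \<and> \<pi> (?c B) = ?c A" if "A \<subseteq> ?L" for A
  proof -
    have "?c A \<in> \<pi> ` quot lam kap" using cls_quot[OF that] bij by (simp add: bij_betw_def)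
    then show ?thesis by (auto simp: quot_eq)
  qed
  then obtain g where g: "\<And>A. A \<subseteq> ?L \<Longrightarrow> g A \<subseteq> ?L" "\<And>A. A \<subseteq> ?L \<Longrightarrow> \<pi> (?c (g A)) = ?c A"
    by metis
  have f_iff: "asub kap (f A) (f B) \<longleftrightarrow> asub kap A B" if A: "A \<subseteq> ?L" and B: "B \<subseteq> ?L" for A B
  proof -
    have AB: "A \<inter> B \<subseteq> ?L" using A by blast
    have "asub kap (f A) (f B) \<longleftrightarrow> \<pi> (?c (A \<inter> B)) = \<pi> (?c A)"
      using qle_cls[OF kap f(1)[OF A] f(1)[OF B]] meet[OF cls_quot[OF A] cls_quot[OF B]]
      by (simp add: qle_def f(2) A B qmeet_cls[OF kap A B])
    also have "\<dots> \<longleftrightarrow> ?c (A \<inter> B) = ?c A"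
      using inj_on_eq_iff[OF bij_betw_imp_inj_on[OF bij] cls_quot[OF AB] cls_quot[OF A]] .
    also have "\<dots> \<longleftrightarrow> asub kap A B"
      using qle_cls[OF kap A B] by (simp add: qle_def qmeet_cls[OF kap A B])
    finally show ?thesis .
  qed
  have fg: "asub kap (f (g A)) A \<and> asub kap A (f (g A))" if "A \<subseteq> ?L" for A
    using f(2)[OF g(1)[OF that]] g(2)[OF that] cls_eq_iff[OF kap f(1)[OF g(1)[OF that]] that] by simp
  have "almost_automorphism ?L kap f g"
    using kap f(1) g(1) f_iff fg by (simp add: almost_automorphism_def)
  then show thesis using that f(2) g(2) by blast
qed

text \<open>A least upper bound in the ambient algebra that lies in \<open>F\<close> is also one in
  \<open>F\<close>; by antisymmetry it is the only one there, so the two notions agree.\<close>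

lemma lt_complete_subalgebraI:
  assumes sub: "subalgebra lam kap F"
    and lub: "\<And>S. S \<subseteq> F \<Longrightarrow> |S| <o mu \<Longrightarrow> \<exists>b\<in>F. is_lub (qle lam kap) (quot lam kap) S b"
    and antisym: "\<And>x y. x \<in> F \<Longrightarrow> y \<in> F \<Longrightarrow> qle lam kap x y \<Longrightarrow> qle lam kap y x \<Longrightarrow> x = y"
  shows "lt_complete_subalgebra lam kap mu F"
proof -
  have FQ: "F \<subseteq> quot lam kap" using sub by (simp add: subalgebra_def)
  have lubF: "\<exists>b. is_lub (qle lam kap) F S b \<and> is_lub (qle lam kap) (quot lam kap) S b"
    if "S \<subseteq> F" "|S| <o mu" for S
    using lub[OF that] FQ unfolding is_lub_def by blast
  moreover have "b = c" if "is_lub (qle lam kap) F S b" "is_lub (qle lam kap) F S c" for S b c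
    using that antisym unfolding is_lub_def by blast
  ultimately show ?thesis
    unfolding lt_complete_subalgebra_def lt_complete_def using sub by blast
qed

lemma qle_antisym:
  assumes "Cinfinite kap" and "x \<in> quot lam kap" "y \<in> quot lam kap" "qle lam kap x y" "qle lam kap y x"
  shows "x = y"
proof -
  obtain A B where "A \<subseteq> Field lam" "x = cls lam kap A" "B \<subseteq> Field lam" "y = cls lam kap B"
    using assms(2,3) by (auto simp: quot_eq)
  then show ?thesis using assms by (simp add: qle_cls cls_eq_iff)
qed

theorem theorem6p2:
  fixes lam :: "'a rel" and kap :: "'b rel"
    and \<pi> :: "'a set set \<Rightarrow> 'a set set"
  assumes "Cinfinite kap" and "Cinfinite lam" and "kap \<le>o lam"
    and "automorphism lam kap \<pi>"
  shows
    "lt_complete_subalgebra lam kap (cf kap) {cls lam kap A | A. fixed_point lam kap \<pi> A} \<and>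
     (\<forall>(eta :: 'c rel) (A :: 'c \<Rightarrow> 'a set).
        Cinfinite eta \<and> regularCard eta \<and> \<not> eta =o cf kap \<and>
        (\<forall>\<alpha>\<in>Field eta. fixed_point lam kap \<pi> (A \<alpha>)) \<and>
        (\<forall>\<beta>\<in>Field eta. |(\<Union>\<alpha>\<in>underS eta \<beta>. A \<alpha>) - A \<beta>| <o kap) \<longrightarrow>
        fixed_point lam kap \<pi> (\<Union>\<alpha>\<in>Field eta. A \<alpha>)) \<and>
     (regularCard kap \<and> kap <o lam \<longrightarrow>
        (\<forall>A. A \<subseteq> Field lam \<longrightarrow>
           (\<exists>B. fixed_point lam kap \<pi> B \<and> A \<subseteq> B \<and> |B| \<le>o |A| +c cardSuc kap))) \<and>
     (cardinality_preserving lam kap \<pi> \<and> natLeq <o kap \<longrightarrow>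
        (\<forall>A. A \<subseteq> Field lam \<longrightarrow>
           (\<exists>B. fixed_point lam kap \<pi> B \<and> A \<subseteq> B \<and> |B| =o |A| )))"
proof -
  note kap = assms(1)
  have Ck: "Card_order kap" and Wk: "Well_order kap" using kap Cinfinite_Well_order by blast+
  let ?L = "Field lam" and ?c = "cls lam kap"
  obtain f g where aut: "almost_automorphism ?L kap f g"
    and f: "\<And>A. A \<subseteq> ?L \<Longrightarrow> \<pi> (?c A) = ?c (f A)"
    and g: "\<And>A. A \<subseteq> ?L \<Longrightarrow> \<pi> (?c (g A)) = ?c A"
    using automorphism_imp_almost_automorphism[OF kap assms(4)] by blast
  interpret almost_automorphism ?L kap f g by (rule aut)
  \<comment> \<open>Supplies the size bound of \<open>card_f_ordLeq\<close> for \<open>g\<close> as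
    well.\<close>
  interpret inv: almost_automorphism ?L kap g f by (rule inverse)
  have fp: "fixed_point lam kap \<pi> A \<longleftrightarrow> almost_fixed A" for A
    using cls_eq_iff[OF kap f_subset[of A], of A] f[of A] unfolding fixed_point_def almost_fixed_def by auto
  let ?F = "{?c A | A. fixed_point lam kap \<pi> A}"
  have pi_quot: "\<pi> (qzero lam kap) = qzero lam kap" "\<pi> (qone lam kap) = qone lam kap"
    "\<And>A B. A \<subseteq> ?L \<Longrightarrow> B \<subseteq> ?L \<Longrightarrow> \<pi> (?c (A \<inter> B)) = qmeet lam kap (\<pi> (?c A)) (\<pi> (?c B))"
    "\<And>A B. A \<subseteq> ?L \<Longrightarrow> B \<subseteq> ?L \<Longrightarrow> \<pi> (?c (A \<union> B)) = qjoin lam kap (\<pi> (?c A)) (\<pi> (?c B))"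
    "\<And>A. A \<subseteq> ?L \<Longrightarrow> \<pi> (?c (?L - A)) = qcompl lam kap (\<pi> (?c A))"
    using assms(4) unfolding automorphism_def
    by (auto simp: quot_eq qmeet_cls[OF kap, symmetric] qjoin_cls[OF kap, symmetric]
        qcompl_cls[OF kap, symmetric])
  have FQ: "?F \<subseteq> quot lam kap" by (auto simp: quot_eq fixed_point_def)
  have "subalgebra lam kap ?F"
    unfolding subalgebra_def
  proof (intro conjI ballI FQ)
    show "qzero lam kap \<in> ?F" "qone lam kap \<in> ?F"
      using pi_quot(1,2) unfolding qzero_def qone_def fixed_point_def by blast+
  next
    fix x y assume "x \<in> ?F" "y \<in> ?F"
    then obtain A B where x: "x = ?c A" "fixed_point lam kap \<pi> A"
      and y: "y = ?c B" "fixed_point lam kap \<pi> B" by blast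
    have "A \<subseteq> ?L" "B \<subseteq> ?L" using x(2) y(2) by (simp_all add: fixed_point_def)
    then have "fixed_point lam kap \<pi> (A \<inter> B)" "fixed_point lam kap \<pi> (A \<union> B)"
      "qmeet lam kap x y = ?c (A \<inter> B)" "qjoin lam kap x y = ?c (A \<union> B)"
      using x y by (auto simp: fixed_point_def pi_quot qmeet_cls[OF kap] qjoin_cls[OF kap])
    then show "qmeet lam kap x y \<in> ?F" "qjoin lam kap x y \<in> ?F" by blast+
  next
    fix x assume "x \<in> ?F"
    then obtain A where x: "x = ?c A" "fixed_point lam kap \<pi> A" by blast
    then have "fixed_point lam kap \<pi> (?L - A)" "qcompl lam kap x = ?c (?L - A)"
      by (auto simp: fixed_point_def pi_quot qcompl_cls[OF kap])
    then show "qcompl lam kap x \<in> ?F" by blast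
  qed
  moreover have "\<exists>b\<in>?F. is_lub (qle lam kap) (quot lam kap) S b" if S: "S \<subseteq> ?F" "|S| <o cf kap" for S
  proof -
    obtain A where A: "\<And>x. x \<in> S \<Longrightarrow> x = ?c (A x)" "\<And>x. x \<in> S \<Longrightarrow> almost_fixed (A x)"
      using S(1) unfolding fp by (simp add: subset_eq) metis
    let ?U = "\<Union>x\<in>S. A x"
    \<comment> \<open>There are fewer than \<open>cf kap\<close> sets, so their union is a least
      upper bound modulo small sets.\<close>
    have least: "asub kap ?U C" if "\<And>x. x \<in> S \<Longrightarrow> asub kap (A x) C" for C
      using kap S(2) that by (rule UN_asub_if_ordLess_cf)
    have AL: "A x \<subseteq> ?L" if "x \<in> S" for x using A(2)[OF that] by (simp add: almost_fixed_def)
    have U: "almost_fixed ?U" using A(2) least by (rule almost_fixed_UN)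
    then have UL: "?U \<subseteq> ?L" by (simp add: almost_fixed_def)
    have "is_lub (qle lam kap) (quot lam kap) S (?c ?U)"
      unfolding is_lub_def
    proof (intro conjI ballI impI)
      show "?c ?U \<in> quot lam kap" using UL by (auto simp: quot_eq)
      show "qle lam kap x (?c ?U)" if "x \<in> S" for x
      proof -
        have "asub kap (A x) ?U" using that by (intro subset_lesssim) blast
        then show ?thesis using qle_cls[OF kap AL[OF that] UL] A(1)[OF that] by simp
      qed
      show "qle lam kap (?c ?U) y" if y: "y \<in> quot lam kap" "\<forall>x\<in>S. qle lam kap x y" for y
      proof -
        obtain C where C: "C \<subseteq> ?L" "y = ?c C" using y(1) by (auto simp: quot_eq)
        have "asub kap (A x) C" if "x \<in> S" for x
          using y(2) that qle_cls[OF kap AL[OF that] C(1)] A(1)[OF that] C(2) by metis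
        then show ?thesis using least qle_cls[OF kap UL C(1)] C(2) by blast
      qed
    qed
    moreover have "?c ?U \<in> ?F" using U fp by blast
    ultimately show ?thesis by blast
  qed
  ultimately have 1: "lt_complete_subalgebra lam kap (cf kap) ?F"
    using qle_antisym[OF kap] FQ by (intro lt_complete_subalgebraI) (blast+)

  have 2: "fixed_point lam kap \<pi> (\<Union>\<alpha>\<in>Field eta. A \<alpha>)"
    if eta: "Cinfinite eta" "regularCard eta" "\<not> eta =o cf kap"
      and A: "\<forall>\<alpha>\<in>Field eta. fixed_point lam kap \<pi> (A \<alpha>)"
      and chain: "\<forall>\<beta>\<in>Field eta. |(\<Union>\<alpha>\<in>underS eta \<beta>. A \<alpha>) - A \<beta>| <o kap"
    for eta :: "'c rel" and A :: "'c \<Rightarrow> 'a set"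
    unfolding fp
  proof (rule almost_fixed_UN)
    show "asub kap (\<Union>\<alpha>\<in>Field eta. A \<alpha>) C" if "\<And>\<alpha>. \<alpha> \<in> Field eta \<Longrightarrow> asub kap (A \<alpha>) C" for C
      using chain that by (intro UN_asub_if_almost_chain[OF kap eta]) (auto simp: asub_def)
  qed (use A fp in blast)

  have 3: "\<exists>B. fixed_point lam kap \<pi> B \<and> A \<subseteq> B \<and> |B| \<le>o |A| +c cardSuc kap"
    if reg: "regularCard kap" and A: "A \<subseteq> ?L" for A
  proof -
    let ?theta = "|A| +c cardSuc kap"
    have suc: "Cinfinite (cardSuc kap)" "regularCard (cardSuc kap)"
      using kap by (rule Cinfinite_cardSuc, rule regularCard_cardSuc)
    \<comment> \<open>The closure has length \<open>kap\<^sup>+\<close>, which is regular and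
      exceeds \<open>cf kap\<close>.\<close>
    have "cf kap <o cardSuc kap" using cf_ordLeq[OF kap] cardSuc_greater[OF Ck] by (rule ordLeq_ordLess_trans)
    then have neq: "\<not> cardSuc kap =o cf kap" using not_ordLess_ordIso ordIso_symmetric by blast
    have theta: "Cinfinite ?theta" using suc(1) by (intro Cinfinite_csum) blast
    have suc_theta: "cardSuc kap \<le>o ?theta" using suc(1) by (intro ordLeq_csum2) blast
    have bound: "|X| +c cardSuc kap \<le>o ?theta" if "|X| \<le>o ?theta" for X :: "'a set"
      using that suc_theta theta suc(1) card_of_Card_order by (intro csum_cinfinite_bound) auto
    obtain B where "almost_fixed B" "A \<subseteq> B" "|B| \<le>o ?theta"
    proof (rule almost_fixed_closure[OF suc neq theta suc_theta])
      show "|f X| \<le>o ?theta" "|g X| \<le>o ?theta" if "X \<subseteq> ?L" "|X| \<le>o ?theta" for X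
        using ordLeq_transitive[OF card_f_ordLeq[OF reg that(1)] bound[OF that(2)]]
          ordLeq_transitive[OF inv.card_f_ordLeq[OF reg that(1)] bound[OF that(2)]] by blast+
      show "|A| \<le>o ?theta" using card_of_Card_order by (rule ordLeq_csum1)
    qed (use A in blast)+
    then show ?thesis using fp by blast
  qed

  have 4: "\<exists>B. fixed_point lam kap \<pi> B \<and> A \<subseteq> B \<and> |B| =o |A|"
    if cp: "cardinality_preserving lam kap \<pi>" and unc: "natLeq <o kap" and A: "A \<subseteq> ?L" for A
  proof (cases "|A| <o kap")
    \<comment> \<open>A small set has a small image, so \<open>A\<close> is already fixed and serves
      as \<open>B\<close>.\<close>
    case True
    then have "almost_fixed A"
      using A f_small[OF A True] unfolding almost_fixed_def by (blast intro: small_asub)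
    then show ?thesis using fp card_of_refl by blast
  next
    case False
    then have kap_A: "kap \<le>o |A|" using not_ordLess_iff_ordLeq[OF Wk card_of_Well_order] by blast
    have CA: "Cinfinite |A|" using cinfinite_mono[OF kap_A] kap card_of_Card_order by blast
    have fA: "|f X| \<le>o |A|" if X: "X \<subseteq> ?L" "|X| \<le>o |A|" for X
    proof -
      obtain Y where Y: "Y \<subseteq> ?L" "|Y| =o |X|" "?c (f X) = ?c Y"
        using cp X(1) f unfolding cardinality_preserving_def by metis
      have "asub kap (f X) Y" using cls_eq_iff[OF kap f_subset[OF X(1)] Y(1)] Y(3) by blast
      then show ?thesis
        using ordIso_ordLeq_trans[OF Y(2) X(2)] kap_A CA by (rule asub_card_ordLeq)
    qed
    \<comment> \<open>Cardinality preservation concerns \<open>\<pi>\<close> only, so it is applied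
      to \<open>g X\<close>, whose image is the class of \<open>X\<close>: a set of size
      \<open>|g X|\<close> then differs from \<open>X\<close> by a small set.\<close>
    have gA: "|g X| \<le>o |A|" if X: "X \<subseteq> ?L" "|X| \<le>o |A|" for X
    proof -
      obtain Y where Y: "Y \<subseteq> ?L" "|Y| =o |g X|" "?c X = ?c Y"
        using cp g_subset[OF X(1)] g[OF X(1)] unfolding cardinality_preserving_def by metis
      have "asub kap Y X" using cls_eq_iff[OF kap X(1) Y(1)] Y(3) by blast
      then have "|Y| \<le>o |A|" using X(2) kap_A CA by (rule asub_card_ordLeq)
      with ordIso_symmetric[OF Y(2)] show ?thesis by (rule ordIso_ordLeq_trans)
    qed
    have "\<exists>B. almost_fixed B \<and> A \<subseteq> B \<and> |B| \<le>o |A|"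
    \<comment> \<open>Length \<open>\<omega>\<close> works unless \<open>cf kap\<close> is
      countable; in that case \<open>\<omega>\<^sub>1\<close> is used, which is at most
      \<open>kap\<close> because \<open>kap\<close> is uncountable.\<close>
    proof (cases "natLeq =o cf kap")
      case False
      have "natLeq \<le>o |A|" using ordLess_imp_ordLeq[OF unc] kap_A by (rule ordLeq_transitive)
      then obtain B where "almost_fixed B" "A \<subseteq> B" "|B| \<le>o |A|"
        using almost_fixed_closure[OF natLeq_Cinfinite regularCard_natLeq False CA _ fA gA A]
          ordLeq_refl[OF card_of_Card_order] by blast
      then show ?thesis by blast
    next
      case True
      let ?eta = "cardSuc natLeq"
      have "natLeq <o ?eta" by (rule cardSuc_greater[OF natLeq_Card_order])
      with ordIso_symmetric[OF True] have "cf kap <o ?eta" by (rule ordIso_ordLess_trans)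
      then have neq: "\<not> ?eta =o cf kap" using not_ordLess_ordIso ordIso_symmetric by blast
      have "?eta \<le>o kap" by (rule cardSuc_least[OF natLeq_Card_order Ck unc])
      then have "?eta \<le>o |A|" using kap_A by (rule ordLeq_transitive)
      then obtain B where "almost_fixed B" "A \<subseteq> B" "|B| \<le>o |A|"
        using almost_fixed_closure[OF Cinfinite_cardSuc[OF natLeq_Cinfinite]
            regularCard_cardSuc[OF natLeq_Cinfinite] neq CA _ fA gA A]
          ordLeq_refl[OF card_of_Card_order] by blast
      then show ?thesis by blast
    qed
    then obtain B where B: "almost_fixed B" "A \<subseteq> B" "|B| \<le>o |A|" by blast
    have "|B| =o |A|" using B(3) card_of_mono1[OF B(2)] by (simp add: ordIso_iff_ordLeq)
    then show ?thesis using B fp by blast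
  qed

  show ?thesis
    by (intro conjI allI impI 1; elim conjE; (rule 2 | rule 3 | rule 4); (intro conjI)?; assumption)
qed

end
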